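(* Let $X$ and $Y$ be second-countable locally compact Hausdorff spaces, let $p:X\times Y\to X$ be the projection map, and let $\Gamma$ be a Radon measure over $X\times Y$. If $\Gamma(K\times Y)<\infty$ for every compact subset $K$ of $X$, then $p_\#\Gamma$ is a Radon measure over $X$ and there exists a $p_\#\Gamma$ Young function $f$ of type $Y$ such that $\Gamma=\mathbf{Y}(p_\#\Gamma,f)$. Moreover, such a function $f$ is $p_\#\Gamma$ almost unique (any two such functions agree $p_\#\Gamma$ almost everywhere).
   Context: Measures are outer measures in Federer's sense: a Radon measure over a locally compact Hausdorff space is finite on compact sets, all open sets are measurable and inner regular by compact sets, and every set is outer regular by open sets. The push-forward is $(p_\#\Gamma)(A)=\Gamma(p^{-1}[A])$. $\mathscr{K}(W)$ is the space of continuous functions $W\to\mathbf{R}$ with compact support. $\mathbf{P}(Y)$ is the space of probability Radon measures over $Y$ with the initial topology induced by the maps $\nu\mapsto\int k\,d\nu$, $k\in\mathscr{K}(Y)$. For a Radon measure $\mu$ over $X$, a $\mu$ Young function of type $Y$ is a $\mu$ measurable function (defined $\mu$ almost everywhere on $X$) with values in $\mathbf{P}(Y)$. The graph measure $\mathbf{Y}(\mu,f)$ is the Radon measure over $X\times Y$ such that $\int\psi\,d\mathbf{Y}(\mu,f)=\int\int\psi(x,y)\,df(x)(y)\,d\mu(x)$ for all $\psi\in\mathscr{K}(X\times Y)$. *)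

theory Defs
  imports "HOL-Analysis.Analysis"
begin

text \<open>
  Following Federer, a measure over a space is an outer measure defined on all subsets; here it is
  a function \<open>'a set \<Rightarrow> ennreal\<close>, the space being the whole type.  Measurability is in the
  sense of Caratheodory.
\<close>

definition caratheodory_sets :: "('a set \<Rightarrow> ennreal) \<Rightarrow> 'a set set" where
  "caratheodory_sets \<phi> = lambda_system UNIV UNIV \<phi>"

definition measure_of_outer :: "('a set \<Rightarrow> ennreal) \<Rightarrow> 'a measure" where
  "measure_of_outer \<phi> = measure_of UNIV (caratheodory_sets \<phi>) \<phi>"

definition outer_integral :: "('a set \<Rightarrow> ennreal) \<Rightarrow> ('a \<Rightarrow> real) \<Rightarrow> real" where
  "outer_integral \<phi> u = integral\<^sup>L (measure_of_outer \<phi>) u"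

definition radon_measure :: "('a::topological_space set \<Rightarrow> ennreal) \<Rightarrow> bool" where
  "radon_measure \<phi> \<longleftrightarrow>
     outer_measure_space UNIV \<phi> \<and>
     (\<forall>K. compact K \<longrightarrow> \<phi> K < \<infinity>) \<and>
     (\<forall>V. open V \<longrightarrow> V \<in> caratheodory_sets \<phi> \<and> \<phi> V = (SUP K\<in>{K. compact K \<and> K \<subseteq> V}. \<phi> K)) \<and>
     (\<forall>A. \<phi> A = (INF V\<in>{V. open V \<and> A \<subseteq> V}. \<phi> V))"

definition push_forward :: "('a \<Rightarrow> 'b) \<Rightarrow> ('a set \<Rightarrow> ennreal) \<Rightarrow> 'b set \<Rightarrow> ennreal" where
  "push_forward p \<phi> A = \<phi> (p -` A)"

definition compactly_supported :: "('a::topological_space \<Rightarrow> real) set" where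
  "compactly_supported = {k. continuous_on UNIV k \<and> compact (closure {x. k x \<noteq> 0})}"

definition prob_radon :: "('a::topological_space set \<Rightarrow> ennreal) set" where
  "prob_radon = {\<nu>. radon_measure \<nu> \<and> \<nu> UNIV = 1}"

text \<open>
  The initial topology on \<open>prob_radon\<close>.  Its carrier is all of \<open>prob_radon\<close>, as one sees
  by taking \<open>k = 0\<close> and \<open>U = UNIV\<close>.
\<close>

definition prob_radon_topology :: "('a::topological_space set \<Rightarrow> ennreal) topology" where
  "prob_radon_topology = topology_generated_by
     {{\<nu> \<in> prob_radon. outer_integral \<nu> k \<in> U} | k U. k \<in> compactly_supported \<and> open U}"

text \<open>
  Functions that are only defined almost everywhere are partial functions; \<open>f -` (Some ` U)\<close> is
  the preimage of \<open>U\<close> under the partial function.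
\<close>

definition young_function ::
  "('a set \<Rightarrow> ennreal) \<Rightarrow> ('a \<rightharpoonup> ('b::topological_space set \<Rightarrow> ennreal)) \<Rightarrow> bool" where
  "young_function \<mu> f \<longleftrightarrow>
     \<mu> (- dom f) = 0 \<and>
     ran f \<subseteq> prob_radon \<and>
     (\<forall>U. openin prob_radon_topology U \<longrightarrow> f -` (Some ` U) \<in> caratheodory_sets \<mu>)"

text \<open>
  The value \<open>0\<close> off the domain of \<open>f\<close> is irrelevant for Young functions, whose domain has a
  null complement.
\<close>

definition young_integral ::
  "('a set \<Rightarrow> ennreal) \<Rightarrow> ('a \<rightharpoonup> ('b set \<Rightarrow> ennreal)) \<Rightarrow> ('a \<times> 'b \<Rightarrow> real) \<Rightarrow> real" where
  "young_integral \<mu> f \<psi> = outer_integral \<mu>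
     (\<lambda>x. case f x of None \<Rightarrow> 0 | Some \<nu> \<Rightarrow> outer_integral \<nu> (\<lambda>y. \<psi> (x, y)))"

definition graph_measure ::
  "('a::topological_space set \<Rightarrow> ennreal) \<Rightarrow> ('a \<rightharpoonup> ('b::topological_space set \<Rightarrow> ennreal)) \<Rightarrow>
   ('a \<times> 'b) set \<Rightarrow> ennreal" where
  "graph_measure \<mu> f = (THE G. radon_measure G \<and>
     (\<forall>\<psi>\<in>compactly_supported. outer_integral G \<psi> = young_integral \<mu> f \<psi>))"

end

theory Submission
  imports Defs "HOL-Probability.Giry_Monad"
begin

text \<open>
  A Radon measure on a second countable locally compact Hausdorff space is determined by its Borel
  restriction, and every locally finite Borel measure extends to a Radon outer measure; this reduces
  everything to Borel measures and kernels.

  The complement of an open subset of \<open>X \<times> Y\<close> is \<open>\<sigma>\<close>-compact and so is its projection.  Hence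
  \<open>{x. {x} \<times> Y \<subseteq> U}\<close> is Borel for open \<open>U\<close>, which makes the push-forward outer regular.

  For the disintegration, Radon--Nikodym densities \<open>h B\<close> of \<open>E \<mapsto> \<Gamma> (E \<times> B)\<close> are taken for \<open>B\<close> in a
  countable algebra which contains a generating algebra together with countably many compact inner
  approximations of its members.  For almost every \<open>x\<close> the set function \<open>B \<mapsto> h B x\<close> is finitely
  additive and inner regular with respect to these compact sets, hence extends to a Borel
  probability measure.  Measurability with respect to the topology of the space of probability
  measures follows since that topology is coarser than one with the countable subbase
  \<open>{\<nu>. r < \<nu> B}\<close>, \<open>r\<close> rational, \<open>B\<close> in a countable base closed under finite unions.

  Conversely, a Young function is a measurable kernel, so its graph measure is the composition of
  the kernel with the base measure; two Young functions with the same graph measure therefore agree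
  almost everywhere on each member of a countable generating algebra.
\<close>

section \<open>Topology of locally compact spaces\<close>

text \<open>Two gaps shape the argument. Densities and kernels are built on Borel sets, whereas
  Young functions are measurable for the possibly larger family of Caratheodory sets of the
  marginal; Borel hulls up to null sets bridge this. And measurability of a Young function concerns
  preimages of all open sets, which are arbitrary unions of basic ones, whereas measurable sets
  tolerate only countable unions; hence the search for a countable subbase.

  Densities satisfy each identity only almost everywhere, so only countably many identities can be
  imposed at a common point. Compact approximations are adjoined just once: additivity is required
  on the larger algebra, and countable additivity is concluded on the smaller one, which already
  generates the Borel sets. Compactness, not a metric, is the source of regularity throughout.

  The marginal of \<open>\<Gamma>\<close> on \<open>Y\<close> may be infinite on every nonempty open
  set. Approximation in \<open>Y\<close> therefore runs simultaneously over the finite pieces of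
  \<open>\<Gamma>\<close> above countably many compact subsets of \<open>X\<close>.\<close>

lemma Hausdorff_space_euclidean_t2 [simp]: "Hausdorff_space (euclidean :: 'a::t2_space topology)"
  unfolding Hausdorff_space_def disjnt_def using hausdorff by (simp, metis)

text \<open>The compact \<open>L\<close> is the room that a cutoff function needs: a function
  vanishing off \<open>U\<close> has its support in \<open>L\<close>.\<close>

lemma compact_open_interpolation:
  fixes K V :: "'a::t2_space set"
  assumes lc: "locally_compact_space (euclidean :: 'a topology)"
    and K: "compact K" and V: "open V" "K \<subseteq> V"
  obtains U L where "open U" "compact L" "K \<subseteq> U" "U \<subseteq> L" "L \<subseteq> V"
proof -
  have nb: "neighbourhood_base_of (compactin euclidean) (euclidean :: 'a topology)"
    using lc locally_compact_space_neighbourhood_base[of "euclidean :: 'a topology"] by simp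
  have ex: "\<exists>U L. open U \<and> compact L \<and> x \<in> U \<and> U \<subseteq> L \<and> L \<subseteq> V" if "x \<in> K" for x
    using nb that V unfolding neighbourhood_base_of
    by (simp add: open_openin[symmetric]) blast
  then obtain U L where UL: "\<And>x. x \<in> K \<Longrightarrow> open (U x) \<and> compact (L x) \<and> x \<in> U x \<and> U x \<subseteq> L x \<and> L x \<subseteq> V"
    by metis
  have "K \<subseteq> (\<Union>x\<in>K. U x)" using UL by auto
  then obtain C where C: "C \<subseteq> K" "finite C" "K \<subseteq> (\<Union>x\<in>C. U x)"
    using compactE_image[OF K, of K U] UL by metis
  show ?thesis
  proof
    show "open (\<Union>x\<in>C. U x)" using C UL by blast
    show "compact (\<Union>x\<in>C. L x)" using C UL by blast
    show "K \<subseteq> (\<Union>x\<in>C. U x)" by fact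
    show "(\<Union>x\<in>C. U x) \<subseteq> (\<Union>x\<in>C. L x)" using C UL by blast
    show "(\<Union>x\<in>C. L x) \<subseteq> V" using C UL by blast
  qed
qed

text \<open>Urysohn's function separates \<open>K\<close> from the complement of the smaller set
  \<open>U\<close> rather than of \<open>V\<close>; its support then stays inside a compact subset
  of \<open>V\<close>.\<close>

lemma compactly_supported_cutoff:
  fixes K V :: "'a::t2_space set"
  assumes lc: "locally_compact_space (euclidean :: 'a topology)"
    and K: "compact K" and V: "open V" "K \<subseteq> V"
  obtains k :: "'a \<Rightarrow> real" where "k \<in> compactly_supported" "indicator K \<le> k" "k \<le> indicator V"
proof -
  obtain U L where UL: "open U" "compact L" "K \<subseteq> U" "U \<subseteq> L" "L \<subseteq> V"
    using compact_open_interpolation[OF lc K V] .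
  have "completely_regular_space (euclidean :: 'a topology)"
    using lc by (intro locally_compact_regular_imp_completely_regular_space) auto
  then obtain k :: "'a \<Rightarrow> real" where k: "continuous_map euclidean (top_of_set {0..1}) k"
     "k ` (-U) \<subseteq> {0}" "k ` K \<subseteq> {1}"
    using Urysohn_completely_regular_compact_closed[of 0 1 "euclidean :: 'a topology" K "- U"]
      K UL(1,3) by (simp add: disjnt_def closed_closedin[symmetric] disjoint_eq_subset_Compl) blast
  have cont: "continuous_on UNIV k" and range: "\<And>x. 0 \<le> k x" "\<And>x. k x \<le> 1"
    using k(1) by (auto simp: continuous_map_in_subtopology image_subset_iff Pi_iff)
  have "{x. k x \<noteq> 0} \<subseteq> L" using k(2) UL by auto
  moreover have "closed L" using UL(2) by (rule compact_imp_closed)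
  ultimately have "closure {x. k x \<noteq> 0} \<subseteq> L" by (rule closure_minimal)
  then have "compact (closure {x. k x \<noteq> 0})"
    using compact_Int_closed[OF UL(2), of "closure {x. k x \<noteq> 0}"] by (simp add: Int_absorb1)
  with cont have "k \<in> compactly_supported" by (simp add: compactly_supported_def)
  moreover have "indicator K \<le> k" using k(3) range by (auto simp: le_fun_def indicator_def)
  moreover have "k \<le> indicator V"
  proof (rule le_funI)
    fix x show "k x \<le> indicator V x"
      using k(2) range(2)[of x] UL(4,5) by (cases "x \<in> U") (auto simp: indicator_def)
  qed
  ultimately show ?thesis by (rule that)
qed

text \<open>The open sets with a compact hull inside \<open>V\<close> cover \<open>V\<close>.
  Lindelof selects countably many of them, and the finite unions of their hulls increase to
  \<open>V\<close>.\<close>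

lemma open_Union_compact:
  fixes V :: "'a::{second_countable_topology, t2_space} set"
  assumes lc: "locally_compact_space (euclidean :: 'a topology)"
    and V: "open V"
  obtains K :: "nat \<Rightarrow> 'a set" where "incseq K" "\<And>n. compact (K n)" "V = (\<Union>n. K n)"
proof -
  have nb: "neighbourhood_base_of (compactin euclidean) (euclidean :: 'a topology)"
    using lc locally_compact_space_neighbourhood_base[of "euclidean :: 'a topology"] by simp
  have ex: "\<exists>U L. open U \<and> compact L \<and> x \<in> U \<and> U \<subseteq> L \<and> L \<subseteq> V" if "x \<in> V" for x
    using nb that V unfolding neighbourhood_base_of
    by (simp add: open_openin[symmetric])
  define F where "F = {U. open U \<and> (\<exists>L. compact L \<and> U \<subseteq> L \<and> L \<subseteq> V)}"
  obtain F' where F': "F' \<subseteq> F" "countable F'" "\<Union>F' = \<Union>F"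
    by (rule Lindelof[of F]) (auto simp: F_def)
  have "\<Union>F = V"
  proof
    show "\<Union>F \<subseteq> V" unfolding F_def by blast
    show "V \<subseteq> \<Union>F"
    proof
      fix x assume "x \<in> V"
      then show "x \<in> \<Union>F" using ex[of x] unfolding F_def by (metis (mono_tags, lifting) UnionI mem_Collect_eq)
    qed
  qed
  with F' have F'V: "\<Union>F' = V" by simp
  have "\<forall>U\<in>F'. \<exists>L. compact L \<and> U \<subseteq> L \<and> L \<subseteq> V"
    using F'(1) unfolding F_def by auto
  then obtain L where L: "\<And>U. U \<in> F' \<Longrightarrow> compact (L U) \<and> U \<subseteq> L U \<and> L U \<subseteq> V"
    by (auto dest!: bchoice)
  \<comment> \<open>The added \<open>{}\<close> keeps the enumerated family nonempty when
    \<open>F'\<close> is empty.\<close>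
  define g where "g = from_nat_into (insert {} (L ` F'))"
  have g: "range g = insert {} (L ` F')"
    unfolding g_def using F'(2) by (intro range_from_nat_into) auto
  have gc: "compact (g n)" for n
    using g L rangeI[of g n] by auto
  show ?thesis
  proof
    show "incseq (\<lambda>n. \<Union>i\<le>n. g i)" by (intro monoI UN_mono) auto
    show "compact (\<Union>i\<le>n. g i)" for n using gc by blast
    have "\<Union>(L ` F') = V" using L F'V by blast
    then have "V = \<Union>(range g)" unfolding g by simp
    then show "V = (\<Union>n. \<Union>i\<le>n. g i)" by auto
  qed
qed

lemma closed_Union_compact:
  fixes C :: "'a::{second_countable_topology, t2_space} set"
  assumes lc: "locally_compact_space (euclidean :: 'a topology)"
    and C: "closed C"
  obtains K :: "nat \<Rightarrow> 'a set" where "incseq K" "\<And>n. compact (K n)" "C = (\<Union>n. K n)"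
proof -
  obtain K :: "nat \<Rightarrow> 'a set" where K: "incseq K" "\<And>n. compact (K n)" "UNIV = (\<Union>n. K n)"
    using open_Union_compact[OF lc open_UNIV] by blast
  show ?thesis
  proof
    show "incseq (\<lambda>n. K n \<inter> C)" using K(1) by (auto simp: incseq_def)
    show "compact (K n \<inter> C)" for n using K(2) C by (rule compact_Int_closed)
    show "C = (\<Union>n. K n \<inter> C)" using K(3) by auto
  qed
qed

text \<open>Intersecting with the open \<open>U n\<close> preserves openness, which a compact
  exhaustion would not; the compact \<open>L n\<close> makes every locally finite measure finite on
  \<open>U n\<close>.\<close>

lemma open_exhaustion:
  assumes lc: "locally_compact_space (euclidean :: 'a::{second_countable_topology, t2_space} topology)"
  obtains U L :: "nat \<Rightarrow> 'a::{second_countable_topology, t2_space} set"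
  where "incseq U" "\<And>n. open (U n)" "\<And>n. compact (L n)" "\<And>n. U n \<subseteq> L n" "(\<Union>n. U n) = UNIV"
proof -
  obtain K :: "nat \<Rightarrow> 'a set" where K: "incseq K" "\<And>n. compact (K n)" "UNIV = (\<Union>n. K n)"
    using open_Union_compact[OF lc open_UNIV] by blast
  have "\<exists>U L. open U \<and> compact L \<and> K n \<subseteq> U \<and> U \<subseteq> L" for n
    using compact_open_interpolation[OF lc K(2) open_UNIV] by (metis subset_UNIV)
  then obtain U L where UL: "\<And>n. open (U n) \<and> compact (L n) \<and> K n \<subseteq> U n \<and> U n \<subseteq> L n" by metis
  show ?thesis
  proof
    show "incseq (\<lambda>n. \<Union>i\<le>n. U i)" by (intro monoI UN_mono) auto
    show "open (\<Union>i\<le>n. U i)" for n using UL by blast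
    show "compact (\<Union>i\<le>n. L i)" for n using UL by blast
    show "(\<Union>i\<le>n. U i) \<subseteq> (\<Union>i\<le>n. L i)" for n using UL by (intro UN_mono) auto
    have "UNIV \<subseteq> (\<Union>n. U n)" unfolding K(3) using UL by (intro UN_mono) auto
    then show "(\<Union>n. \<Union>i\<le>n. U i) = UNIV" by auto
  qed
qed

lemma locally_compact_space_euclidean_prod:
  assumes "locally_compact_space (euclidean :: 'a::topological_space topology)"
    and "locally_compact_space (euclidean :: 'b::topological_space topology)"
  shows "locally_compact_space (euclidean :: ('a \<times> 'b) topology)"
  using assms locally_compact_space_prod_topology[of "euclidean :: 'a topology" "euclidean :: 'b topology"]
  by simp

section \<open>Radon measures and their Borel restrictions\<close>

definition borel_part :: "('a::topological_space set \<Rightarrow> ennreal) \<Rightarrow> 'a measure" where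
  "borel_part \<phi> = measure_of UNIV (sets borel) \<phi>"

text \<open>Outer regularity forces this value once the open sets are measured by
  \<open>N\<close>.\<close>

definition radon_extension :: "'a::topological_space measure \<Rightarrow> 'a set \<Rightarrow> ennreal" where
  "radon_extension N A = (INF V\<in>{V. open V \<and> A \<subseteq> V}. emeasure N V)"

section \<open>Measurable and null sets of an outer measure\<close>

lemma caratheodory_sets_iff:
  "A \<in> caratheodory_sets \<phi> \<longleftrightarrow> (\<forall>S. \<phi> (A \<inter> S) + \<phi> (- A \<inter> S) = \<phi> S)"
  by (auto simp: caratheodory_sets_def lambda_system_def Compl_eq_Diff_UNIV)

context
  fixes \<phi> :: "'a set \<Rightarrow> ennreal"
  assumes om: "outer_measure_space UNIV \<phi>"
begin

lemma outer_measure_mono: "A \<subseteq> B \<Longrightarrow> \<phi> A \<le> \<phi> B"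
  using om by (auto simp: outer_measure_space_def increasing_def)

lemma outer_measure_Un: "\<phi> (A \<union> B) \<le> \<phi> A + \<phi> B"
proof -
  interpret sigma_algebra UNIV "UNIV :: 'a set set"
    using sigma_algebra_Pow[of UNIV] by simp
  have "subadditive UNIV \<phi>"
    using om by (intro countably_subadditive_subadditive) (auto simp: outer_measure_space_def)
  then have "\<phi> (A \<union> (B - A)) \<le> \<phi> A + \<phi> (B - A)"
    by (rule subadditiveD) auto
  also have "\<dots> \<le> \<phi> A + \<phi> B"
    by (intro add_left_mono outer_measure_mono) auto
  finally show ?thesis by simp
qed

lemma measure_space_caratheodory: "measure_space UNIV (caratheodory_sets \<phi>) \<phi>"
  using sigma_algebra.caratheodory_lemma[OF sigma_algebra_Pow[of UNIV], of \<phi>] om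
  by (simp add: caratheodory_sets_def)

lemma sigma_algebra_caratheodory: "sigma_algebra UNIV (caratheodory_sets \<phi>)"
  using measure_space_caratheodory by (simp add: measure_space_def)

lemma sets_measure_of_outer: "sets (measure_of_outer \<phi>) = caratheodory_sets \<phi>"
  unfolding measure_of_outer_def
  using sigma_algebra.sets_measure_of_eq[OF sigma_algebra_caratheodory] .

lemma emeasure_measure_of_outer:
  "A \<in> caratheodory_sets \<phi> \<Longrightarrow> emeasure (measure_of_outer \<phi>) A = \<phi> A"
  unfolding measure_of_outer_def using measure_space_caratheodory
  by (intro emeasure_measure_of_sigma) (auto simp: measure_space_def)

lemma caratheodory_null:
  assumes "\<phi> A = 0"
  shows "A \<in> caratheodory_sets \<phi>"
  unfolding caratheodory_sets_iff
proof (intro allI antisym)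
  fix S
  have "\<phi> (A \<inter> S) \<le> \<phi> A" by (rule outer_measure_mono) auto
  then have "\<phi> (A \<inter> S) = 0" using assms by simp
  moreover have "\<phi> (- A \<inter> S) \<le> \<phi> S" by (rule outer_measure_mono) auto
  ultimately show "\<phi> (A \<inter> S) + \<phi> (- A \<inter> S) \<le> \<phi> S" by simp
  have "\<phi> ((A \<inter> S) \<union> (- A \<inter> S)) \<le> \<phi> (A \<inter> S) + \<phi> (- A \<inter> S)" by (rule outer_measure_Un)
  then show "\<phi> S \<le> \<phi> (A \<inter> S) + \<phi> (- A \<inter> S)"
    by (simp add: Int_Un_distrib2[symmetric])
qed

lemma null_iff_null_sets: "\<phi> A = 0 \<longleftrightarrow> A \<in> null_sets (measure_of_outer \<phi>)"
  using caratheodory_null[of A] emeasure_measure_of_outer[of A]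
  by (auto simp: null_sets_def sets_measure_of_outer)

text \<open>Null sets of an outer measure are Caratheodory measurable, so the exceptional set is
  itself measurable and null, not just contained in a null set. Almost uniqueness is stated in this
  form.\<close>

lemma AE_measure_of_outer_iff: "(AE x in measure_of_outer \<phi>. P x) \<longleftrightarrow> \<phi> {x. \<not> P x} = 0"
proof
  assume "AE x in measure_of_outer \<phi>. P x"
  then obtain N where N: "{x \<in> space (measure_of_outer \<phi>). \<not> P x} \<subseteq> N"
    "N \<in> null_sets (measure_of_outer \<phi>)"
    by (auto elim!: AE_E simp: null_sets_def)
  then have "\<phi> {x. \<not> P x} \<le> \<phi> N"
    by (intro outer_measure_mono) (auto simp: measure_of_outer_def)
  moreover have "\<phi> N = 0" using N(2) by (simp add: null_iff_null_sets)
  ultimately show "\<phi> {x. \<not> P x} = 0" by simp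
next
  assume "\<phi> {x. \<not> P x} = 0"
  then show "AE x in measure_of_outer \<phi>. P x"
    unfolding null_iff_null_sets by (rule AE_I') auto
qed

end

lemma space_measure_of_outer [simp]: "space (measure_of_outer \<phi>) = UNIV"
  by (simp add: measure_of_outer_def)

lemma space_borel_part [simp]: "space (borel_part \<phi>) = UNIV"
  by (simp add: borel_part_def)

lemma sets_borel_part [simp, measurable_cong]: "sets (borel_part \<phi>) = sets borel"
  using sets.sigma_sets_eq[of borel] by (simp add: borel_part_def)

section \<open>Restriction of a Radon measure to the Borel sets\<close>

lemma radon_outer_measure: "radon_measure \<phi> \<Longrightarrow> outer_measure_space UNIV \<phi>"
  by (simp add: radon_measure_def)

lemma radon_finite_compact: "radon_measure \<phi> \<Longrightarrow> compact K \<Longrightarrow> \<phi> K < \<infinity>"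
  unfolding radon_measure_def by blast

lemma radon_outer_regular:
  "radon_measure \<phi> \<Longrightarrow> \<phi> A = (INF V\<in>{V. open V \<and> A \<subseteq> V}. \<phi> V)"
  unfolding radon_measure_def by blast

lemma radon_borel_caratheodory:
  assumes "radon_measure \<phi>"
  shows "sets borel \<subseteq> caratheodory_sets \<phi>"
proof -
  interpret sigma_algebra UNIV "caratheodory_sets \<phi>"
    by (rule sigma_algebra_caratheodory[OF radon_outer_measure[OF assms]])
  have "sigma_sets UNIV {S. open S} \<subseteq> caratheodory_sets \<phi>"
    using assms unfolding radon_measure_def by (intro sigma_sets_subset) blast
  then show ?thesis by (simp add: borel_def)
qed

lemma emeasure_borel_part:
  assumes "radon_measure \<phi>" "A \<in> sets borel"
  shows "emeasure (borel_part \<phi>) A = \<phi> A"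
proof -
  have "measure_space UNIV (sets borel) \<phi>"
    using sets.sigma_algebra_axioms[of borel]
    by (intro measure_down[OF measure_space_caratheodory[OF radon_outer_measure[OF assms(1)]]]
      radon_borel_caratheodory assms) auto
  then show ?thesis
    unfolding borel_part_def using assms(2)
    by (intro emeasure_measure_of_sigma) (auto simp: measure_space_def)
qed

lemma borel_part_subalgebra:
  assumes "radon_measure \<phi>"
  shows "sets (borel_part \<phi>) \<subseteq> sets (measure_of_outer \<phi>)"
    and "\<And>A. A \<in> sets (borel_part \<phi>) \<Longrightarrow> emeasure (borel_part \<phi>) A = emeasure (measure_of_outer \<phi>) A"
  using radon_borel_caratheodory[OF assms] emeasure_borel_part[OF assms]
    emeasure_measure_of_outer[OF radon_outer_measure[OF assms]]
  by (auto simp: sets_measure_of_outer[OF radon_outer_measure[OF assms]])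

lemma outer_integral_borel:
  assumes "radon_measure \<phi>" "u \<in> borel_measurable borel"
  shows "outer_integral \<phi> u = integral\<^sup>L (borel_part \<phi>) u"
  unfolding outer_integral_def using assms
  by (intro integral_subalgebra[symmetric] borel_part_subalgebra)
    (auto simp: measurable_cong_sets[OF sets_borel_part refl])

section \<open>Test functions with compact support\<close>

lemma compactly_supportedD:
  assumes "k \<in> compactly_supported"
  shows "continuous_on UNIV k" "k \<in> borel_measurable borel"
    "\<exists>B\<ge>0. \<exists>K. compact K \<and> closed K \<and> (\<forall>x. \<bar>k x\<bar> \<le> B * indicator K x)"
proof -
  let ?K = "closure {x. k x \<noteq> 0}"
  show c: "continuous_on UNIV k" using assms by (simp add: compactly_supported_def)
  then show "k \<in> borel_measurable borel" by (rule borel_measurable_continuous_onI)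
  have K: "compact ?K" using assms by (simp add: compactly_supported_def)
  have "compact (k ` ?K)"
    using K c by (intro compact_continuous_image) (auto intro: continuous_on_subset)
  then obtain B where B: "\<And>x. x \<in> ?K \<Longrightarrow> \<bar>k x\<bar> \<le> B"
    using compact_imp_bounded[of "k ` ?K"] by (auto simp: bounded_iff)
  \<comment> \<open>If the support is empty, \<open>B\<close> is arbitrary and may be
    negative.\<close>
  have "\<bar>k x\<bar> \<le> max B 0 * indicator ?K x" for x
    using B[of x] closure_subset[of "{x. k x \<noteq> 0}"] by (auto simp: indicator_def)
  with K show "\<exists>B\<ge>0. \<exists>K. compact K \<and> closed K \<and> (\<forall>x. \<bar>k x\<bar> \<le> B * indicator K x)"
    by (intro exI[of _ "max B 0"] conjI exI[of _ ?K]) auto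
qed

lemma compactly_supported_integrable:
  assumes sN: "sets N = sets borel" and fin: "\<And>K. compact K \<Longrightarrow> emeasure N K < \<infinity>"
    and k: "k \<in> compactly_supported"
  shows "integrable N k"
proof -
  obtain B K where BK: "B \<ge> 0" "compact K" "closed K" "\<And>x. \<bar>k x\<bar> \<le> B * indicator K x"
    using compactly_supportedD(3)[OF k] by blast
  have "integrable N (\<lambda>x. B * indicator K x)"
    using fin[OF BK(2)] BK(3) sN by (intro integrable_mult_right integrable_real_indicator) auto
  then show ?thesis
    by (rule Bochner_Integration.integrable_bound)
      (use compactly_supportedD(2)[OF k] BK in
        \<open>auto simp: measurable_cong_sets[OF sN refl] intro!: AE_I2 order_trans[OF BK(4)]\<close>)
qed

text \<open>The functions are chosen before the measure: integrals of fixed test functions recover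
  the mass of \<open>V\<close> for all Radon measures at once. This serves both uniqueness and the
  measurability of masses as functions of the measure. Each integral lies between the masses of
  \<open>K n\<close> and of \<open>V\<close>.\<close>

lemma cutoff_sequence:
  fixes V :: "'a::{second_countable_topology, t2_space} set"
  assumes lc: "locally_compact_space (euclidean :: 'a topology)" and V: "open V"
  obtains k :: "nat \<Rightarrow> 'a \<Rightarrow> real" where "\<And>n. k n \<in> compactly_supported"
    "\<And>\<phi>. radon_measure \<phi> \<Longrightarrow> \<phi> V = (SUP n. ennreal (outer_integral \<phi> (k n)))"
proof -
  obtain K :: "nat \<Rightarrow> 'a set" where K: "incseq K" "\<And>n. compact (K n)" "V = (\<Union>n. K n)"
    using open_Union_compact[OF lc V] by blast
  have "\<exists>k :: 'a \<Rightarrow> real. k \<in> compactly_supported \<and> indicator (K n) \<le> k \<and> k \<le> indicator V" for n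
    using compactly_supported_cutoff[OF lc K(2)[of n] V] K(3) by (metis UN_upper UNIV_I)
  then obtain k :: "nat \<Rightarrow> 'a \<Rightarrow> real" where k: "\<And>n. k n \<in> compactly_supported"
    "\<And>n. indicator (K n) \<le> k n" "\<And>n. k n \<le> indicator V" by metis
  have bK: "K n \<in> sets borel" for n using K(2)[of n] by (intro borel_closed compact_imp_closed)
  show ?thesis
  proof
    show "k n \<in> compactly_supported" for n by fact
    fix \<phi> :: "'a set \<Rightarrow> ennreal" assume \<phi>: "radon_measure \<phi>"
    let ?N = "borel_part \<phi>"
    have k0: "0 \<le> k n x" for n x
      using le_funD[OF k(2)[of n], of x] by (rule order_trans[rotated]) simp
    have k1: "1 \<le> k n x" if "x \<in> K n" for n x
      using le_funD[OF k(2)[of n], of x] that by simp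
    have k2: "k n x \<le> 0" if "x \<notin> V" for n x
      using le_funD[OF k(3)[of n], of x] that by simp
    have k3: "k n x \<le> 1" for n x
      using le_funD[OF k(3)[of n], of x] by (rule order_trans) simp
    have e: "ennreal (outer_integral \<phi> (k n)) = (\<integral>\<^sup>+x. ennreal (k n x) \<partial>?N)" for n
      using compactly_supportedD(2)[OF k(1)] k0
        compactly_supported_integrable[OF sets_borel_part _ k(1)]
        emeasure_borel_part[OF \<phi>] radon_finite_compact[OF \<phi>]
      by (simp add: outer_integral_borel[OF \<phi>] nn_integral_eq_integral borel_closed compact_imp_closed)
    have lower: "\<phi> (K n) \<le> ennreal (outer_integral \<phi> (k n))" for n
    proof -
      have "\<phi> (K n) = (\<integral>\<^sup>+x. indicator (K n) x \<partial>?N)"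
        using bK by (simp add: emeasure_borel_part[OF \<phi>])
      also have "\<dots> \<le> (\<integral>\<^sup>+x. ennreal (k n x) \<partial>?N)"
        using k1 by (intro nn_integral_mono) (auto simp: indicator_def)
      finally show ?thesis by (simp add: e)
    qed
    have upper: "ennreal (outer_integral \<phi> (k n)) \<le> \<phi> V" for n
    proof -
      have "(\<integral>\<^sup>+x. ennreal (k n x) \<partial>?N) \<le> (\<integral>\<^sup>+x. indicator V x \<partial>?N)"
        using k2 k3 by (intro nn_integral_mono) (auto simp: indicator_def ennreal_neg)
      also have "\<dots> = \<phi> V" using V by (simp add: emeasure_borel_part[OF \<phi>])
      finally show ?thesis by (simp add: e)
    qed
    have "\<phi> V = emeasure ?N (\<Union>n. K n)" using V K(3) by (simp add: emeasure_borel_part[OF \<phi>])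
    also have "\<dots> = (SUP n. emeasure ?N (K n))"
      using K(1) bK by (intro SUP_emeasure_incseq[symmetric]) auto
    also have "\<dots> \<le> (SUP n. ennreal (outer_integral \<phi> (k n)))"
      using lower bK by (intro SUP_mono) (auto simp: emeasure_borel_part[OF \<phi>])
    finally show "\<phi> V = (SUP n. ennreal (outer_integral \<phi> (k n)))"
      using upper by (intro antisym SUP_least) auto
  qed
qed

lemma radon_measure_eqI_open:
  assumes "radon_measure \<phi>" "radon_measure \<psi>" "\<And>V. open V \<Longrightarrow> \<phi> V = \<psi> V"
  shows "\<phi> = \<psi>"
proof
  fix A show "\<phi> A = \<psi> A"
    unfolding radon_outer_regular[OF assms(1), of A] radon_outer_regular[OF assms(2), of A]
    using assms(3) by (intro INF_cong) auto
qed

text \<open>Integrals of test functions give the masses of open sets by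
  \<open>cutoff_sequence\<close>, and outer regularity does the rest.\<close>

lemma radon_measure_eqI:
  fixes \<phi> \<psi> :: "'a::{second_countable_topology, t2_space} set \<Rightarrow> ennreal"
  assumes lc: "locally_compact_space (euclidean :: 'a topology)"
    and R: "radon_measure \<phi>" "radon_measure \<psi>"
    and eq: "\<And>k. k \<in> compactly_supported \<Longrightarrow> outer_integral \<phi> k = outer_integral \<psi> k"
  shows "\<phi> = \<psi>"
proof (rule radon_measure_eqI_open[OF R])
  fix V :: "'a set" assume V: "open V"
  obtain k :: "nat \<Rightarrow> 'a \<Rightarrow> real" where k: "\<And>n. k n \<in> compactly_supported"
    "\<And>\<phi>. radon_measure \<phi> \<Longrightarrow> \<phi> V = (SUP n. ennreal (outer_integral \<phi> (k n)))"
    using cutoff_sequence[OF lc V] by blast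
  show "\<phi> V = \<psi> V"
    unfolding k(2)[OF R(1)] k(2)[OF R(2)] eq[OF k(1)] ..
qed

section \<open>Regularity of Borel measures\<close>

lemma suminf_half_ennreal:
  assumes "0 \<le> e"
  shows "(\<Sum>i. ennreal (e * (1/2) ^ Suc i)) = ennreal e"
proof -
  have "(\<lambda>i. e * (1/2) ^ Suc i) sums e"
    using sums_mult[OF power_half_series, of e] by simp
  then show ?thesis using assms by (intro suminf_ennreal_eq) auto
qed

lemma emeasure_UN_half_le:
  assumes "\<And>i. D i \<in> sets N" "\<And>i. emeasure N (D i) \<le> ennreal (e * (1/2) ^ Suc i)" "0 \<le> e"
  shows "emeasure N (\<Union>i. D i) \<le> ennreal e"
proof -
  have "emeasure N (\<Union>i. D i) \<le> (\<Sum>i. emeasure N (D i))"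
    using assms(1) by (intro emeasure_subadditive_countably) auto
  also have "\<dots> \<le> (\<Sum>i. ennreal (e * (1/2) ^ Suc i))"
    using assms(2) by (intro suminf_le) auto
  finally show ?thesis using suminf_half_ennreal[OF assms(3)] by simp
qed

lemma (in finite_measure) incseq_approx:
  assumes A: "\<And>n. A n \<in> sets M" "incseq A" and "0 < e"
  shows "\<exists>n. emeasure M ((\<Union>i. A i) - A n) \<le> ennreal e"
proof -
  have "(\<lambda>n. emeasure M ((\<Union>i. A i) - A n)) \<longlonglongrightarrow> emeasure M (\<Inter>n. (\<Union>i. A i) - A n)"
    using A by (intro Lim_emeasure_decseq) (auto simp: decseq_def incseq_def)
  also have "(\<Inter>n. (\<Union>i. A i) - A n) = {}" by auto
  finally have "eventually (\<lambda>n. emeasure M ((\<Union>i. A i) - A n) < ennreal e) sequentially"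
    using \<open>0 < e\<close> by (intro order_tendstoD(2)) auto
  then obtain n where "emeasure M ((\<Union>i. A i) - A n) < ennreal e"
    by (auto simp: eventually_sequentially)
  then show ?thesis by (auto intro: less_imp_le)
qed

text \<open>Enclosures \<open>C \<subseteq> A \<subseteq> V\<close> turn into enclosures of the
  complement, so the sets that admit them form a sigma-algebra; it contains the open sets because
  these are sigma-compact.\<close>

lemma finite_borel_regular:
  fixes N :: "'a::{second_countable_topology, t2_space} measure"
  assumes lc: "locally_compact_space (euclidean :: 'a topology)"
    and sN[measurable_cong]: "sets N = sets borel" and fin: "finite_measure N"
    and A: "A \<in> sets borel" and "0 < e"
  shows "\<exists>C V. closed C \<and> open V \<and> C \<subseteq> A \<and> A \<subseteq> V \<and> emeasure N (V - C) \<le> ennreal e"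
proof -
  interpret finite_measure N by fact
  have "A \<in> sigma_sets UNIV {S. open S}" using A by (simp add: borel_def)
  then show ?thesis using \<open>0 < e\<close>
  proof (induction arbitrary: e)
    case (Basic A)
    then have op: "open A" by simp
    then obtain K where K: "incseq K" "\<And>n. compact (K n)" "A = (\<Union>n. K n)"
      using open_Union_compact[OF lc] by blast
    have cl: "closed (K n)" for n using K(2) by (rule compact_imp_closed)
    then have "\<exists>n. emeasure N (A - K n) \<le> ennreal e"
      unfolding K(3) using K(1) \<open>0 < e\<close> by (intro incseq_approx) auto
    with op cl K(3) show ?case by blast
  next
    case Empty
    show ?case by (intro exI[of _ "{}"]) simp
  next
    case (Compl A)
    then obtain C V where CV: "closed C" "open V" "C \<subseteq> A" "A \<subseteq> V" "emeasure N (V - C) \<le> ennreal e"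
      using Compl.IH[OF Compl.prems] by blast
    moreover have "(- C) - (- V) = V - C" by auto
    ultimately show ?case by (intro exI[of _ "- V"] exI[of _ "- C"]) auto
  next
    case (Union A)
    \<comment> \<open>Half of \<open>e\<close> is spent on the gaps \<open>V i - C i\<close>; the
      other half pays for replacing the union of all \<open>C i\<close>, which may fail to be
      closed, by a finite union.\<close>
    have "\<exists>C V. closed C \<and> open V \<and> C \<subseteq> A i \<and> A i \<subseteq> V \<and>
       emeasure N (V - C) \<le> ennreal (e/2 * (1/2) ^ Suc i)" for i
      using Union.IH[of "e/2 * (1/2) ^ Suc i" i] \<open>0 < e\<close> by simp
    then obtain C V where CV: "\<And>i. closed (C i)" "\<And>i. open (V i)" "\<And>i. C i \<subseteq> A i" "\<And>i. A i \<subseteq> V i"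
       "\<And>i. emeasure N (V i - C i) \<le> ennreal (e/2 * (1/2) ^ Suc i)"
      by metis
    define D where "D n = (\<Union>i\<le>n. C i)" for n
    have clD: "closed (D n)" for n unfolding D_def using CV(1) by (intro closed_UN) auto
    have incD: "incseq D" unfolding D_def by (intro monoI UN_mono) auto
    have UD: "(\<Union>i. D i) = (\<Union>i. C i)" unfolding D_def by auto
    have "\<exists>n. emeasure N ((\<Union>i. D i) - D n) \<le> ennreal (e/2)"
      using \<open>0 < e\<close> clD incD by (intro incseq_approx) (auto simp: sN)
    then obtain n where n: "emeasure N ((\<Union>i. D i) - D n) \<le> ennreal (e/2)" ..
    have "emeasure N ((\<Union>i. V i) - D n) \<le> emeasure N ((\<Union>i. V i - C i) \<union> ((\<Union>i. D i) - D n))"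
      using CV clD by (intro emeasure_mono) (auto simp: UD sN)
    also have "\<dots> \<le> emeasure N (\<Union>i. V i - C i) + emeasure N ((\<Union>i. D i) - D n)"
      using CV clD by (intro emeasure_subadditive) (auto simp: sN)
    also have "\<dots> \<le> ennreal (e/2) + ennreal (e/2)"
      using CV \<open>0 < e\<close> by (intro add_mono n emeasure_UN_half_le) (auto simp: sN)
    also have "\<dots> = ennreal e" using \<open>0 < e\<close> by (simp add: ennreal_plus[symmetric])
    finally have "emeasure N ((\<Union>i. V i) - D n) \<le> ennreal e" .
    moreover have "open (\<Union>i. V i)" using CV by auto
    moreover have "D n \<subseteq> (\<Union>i. A i)"
      unfolding D_def by (rule UN_mono) (auto simp: CV(3))
    moreover have "(\<Union>i. A i) \<subseteq> (\<Union>i. V i)"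
      by (rule UN_mono) (auto simp: CV(4))
    ultimately show ?case using clD[of n] by (intro exI[of _ "D n"] exI[of _ "\<Union>i. V i"] conjI)
  qed
qed

lemma finite_borel_approx:
  fixes N :: "'a::{second_countable_topology, t2_space} measure"
  assumes lc: "locally_compact_space (euclidean :: 'a topology)"
    and sN: "sets N = sets borel" and fin: "finite_measure N"
    and A: "A \<in> sets borel" and "0 < e"
  shows "\<exists>C. closed C \<and> C \<subseteq> A \<and> emeasure N (A - C) \<le> ennreal e"
    and "\<exists>V. open V \<and> A \<subseteq> V \<and> emeasure N (V - A) \<le> ennreal e"
proof -
  obtain C V where CV: "closed C" "open V" "C \<subseteq> A" "A \<subseteq> V" "emeasure N (V - C) \<le> ennreal e"
    using finite_borel_regular[OF assms] by blast
  have "emeasure N (A - C) \<le> emeasure N (V - C)" "emeasure N (V - A) \<le> emeasure N (V - C)"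
    using CV sN by (intro emeasure_mono; auto)+
  with CV show "\<exists>C. closed C \<and> C \<subseteq> A \<and> emeasure N (A - C) \<le> ennreal e"
    and "\<exists>V. open V \<and> A \<subseteq> V \<and> emeasure N (V - A) \<le> ennreal e"
    by (auto intro: order_trans)
qed

text \<open>One sequence serves countably many finite measures: the closed approximations for all
  measures and all accuracies are cut into compact sets, and these are merged diagonally.\<close>

lemma finite_borel_inner_regular:
  fixes N :: "nat \<Rightarrow> 'a::{second_countable_topology, t2_space} measure"
  assumes lc: "locally_compact_space (euclidean :: 'a topology)"
    and sN: "\<And>j. sets (N j) = sets borel" and fin: "\<And>j. finite_measure (N j)"
    and A: "A \<in> sets borel"
  obtains K :: "nat \<Rightarrow> 'a set" where "incseq K" "\<And>n. compact (K n)" "\<And>n. K n \<subseteq> A"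
    "\<And>j. emeasure (N j) (A - (\<Union>n. K n)) = 0"
proof -
  have "\<exists>C. closed C \<and> C \<subseteq> A \<and> emeasure (N j) (A - C) \<le> ennreal (1 / Suc m)" for j m
    by (intro finite_borel_approx(1)[OF lc sN fin A]) simp
  then obtain C where C: "\<And>j m. closed (C j m)" "\<And>j m. C j m \<subseteq> A"
     "\<And>j m. emeasure (N j) (A - C j m) \<le> ennreal (1 / Suc m)"
    by metis
  have "\<exists>K. (\<forall>n :: nat. compact (K n)) \<and> C j m = (\<Union>n. K n)" for j m
    using closed_Union_compact[OF lc C(1)] by metis
  then obtain K where K: "\<And>j m n :: nat. compact (K j m n)" "\<And>j m. C j m = (\<Union>n. K j m n)"
    by metis
  \<comment> \<open>The indices run over the measures, the accuracies \<open>1 / Suc m\<close> and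
    the compact pieces of \<open>C j m\<close>.\<close>
  define L where "L n = (\<Union>j\<le>n. \<Union>m\<le>n. \<Union>i\<le>n. K j m i)" for n
  have KL: "K j m i \<subseteq> (\<Union>n. L n)" for j m i
  proof -
    have "K j m i \<subseteq> L (max j (max m i))"
      unfolding L_def by (fastforce simp: le_max_iff_disj)
    then show ?thesis by blast
  qed
  have cL: "compact (L n)" for n unfolding L_def using K(1) by (intro compact_UN) auto
  then have bL: "(\<Union>n. L n) \<in> sets borel"
    by (intro sets.countable_UN) (auto intro: borel_closed compact_imp_closed)
  show ?thesis
  proof
    show "incseq L" unfolding L_def by (intro monoI UN_mono) auto
    show "compact (L n)" for n by (rule cL)
    show "L n \<subseteq> A" for n
    proof -
      have "K j m i \<subseteq> A" for j m i using K(2)[of j m] C(2)[of j m] by auto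
      then show ?thesis unfolding L_def by (intro UN_least) auto
    qed
    show "emeasure (N j) (A - (\<Union>n. L n)) = 0" for j
    proof -
      have le: "emeasure (N j) (A - (\<Union>n. L n)) \<le> ennreal (1 / Suc m)" for m
      proof -
        have "C j m \<subseteq> (\<Union>n. L n)" unfolding K(2) using KL by (intro UN_least) auto
        then have "emeasure (N j) (A - (\<Union>n. L n)) \<le> emeasure (N j) (A - C j m)"
          using C(1)[of j m] A sN[of j] by (intro emeasure_mono) auto
        with C(3)[of j m] show ?thesis by (rule order_trans[rotated])
      qed
      have "(\<lambda>m. ennreal (1 / Suc m)) \<longlonglongrightarrow> ennreal 0"
        using LIMSEQ_inverse_real_of_nat by (intro tendsto_ennrealI) (simp add: field_simps)
      then have "emeasure (N j) (A - (\<Union>n. L n)) \<le> ennreal 0"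
        using le by (intro LIMSEQ_le_const) auto
      then show ?thesis by simp
    qed
  qed
qed

text \<open>The measure is only locally finite, so the error \<open>e\<close> is distributed over
  its finite restrictions to the \<open>U n\<close>. Since the \<open>U n\<close> are open, the
  pieces \<open>V n \<inter> U n\<close> can be united to an open set.\<close>

lemma borel_outer_approx:
  fixes N :: "'a::{second_countable_topology, t2_space} measure"
  assumes lc: "locally_compact_space (euclidean :: 'a topology)"
    and sN: "sets N = sets borel" and fin: "\<And>K. compact K \<Longrightarrow> emeasure N K < \<infinity>"
    and A: "A \<in> sets borel" and "0 < e"
  shows "\<exists>V. open V \<and> A \<subseteq> V \<and> emeasure N (V - A) \<le> ennreal e"
proof -
  obtain U L :: "nat \<Rightarrow> 'a set" where U: "incseq U" "\<And>n. open (U n)" "\<And>n. compact (L n)"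
    "\<And>n. U n \<subseteq> L n" "(\<Union>n. U n) = UNIV"
    using open_exhaustion[OF lc] by blast
  have bU: "U n \<in> sets N" for n using U sN by auto
  have bL: "L n \<in> sets N" for n using U sN by (auto intro: borel_closed compact_imp_closed)
  define Nn where "Nn n = density N (indicator (U n))" for n
  have em: "emeasure (Nn n) B = emeasure N (U n \<inter> B)" if "B \<in> sets borel" for n B
    unfolding Nn_def using bU that sN by (intro emeasure_restricted) auto
  have "finite_measure (Nn n)" for n
  proof (rule finite_measureI)
    have "emeasure (Nn n) (space (Nn n)) = emeasure N (U n)"
      using em[of UNIV n] sets_eq_imp_space_eq[OF sN] by (simp add: Nn_def)
    also have "\<dots> \<le> emeasure N (L n)" using U bL by (intro emeasure_mono) auto
    also have "\<dots> < \<infinity>" using U fin by auto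
    finally show "emeasure (Nn n) (space (Nn n)) \<noteq> \<infinity>" by simp
  qed
  then have "\<exists>V. open V \<and> A \<subseteq> V \<and> emeasure (Nn n) (V - A) \<le> ennreal (e * (1/2) ^ Suc n)" for n
    using \<open>0 < e\<close> sN by (intro finite_borel_approx(2)[OF lc _ _ A]) (auto simp: Nn_def)
  then obtain V where V: "\<And>n. open (V n)" "\<And>n. A \<subseteq> V n"
    "\<And>n. emeasure (Nn n) (V n - A) \<le> ennreal (e * (1/2) ^ Suc n)"
    by metis
  have "emeasure N ((\<Union>n. V n \<inter> U n) - A) = emeasure N (\<Union>n. U n \<inter> (V n - A))"
    by (intro arg_cong[where f = "emeasure N"]) auto
  also have "\<dots> \<le> ennreal e"
    using \<open>0 < e\<close> V A bU sN em[of "V _ - A"] by (intro emeasure_UN_half_le) auto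
  finally have "emeasure N ((\<Union>n. V n \<inter> U n) - A) \<le> ennreal e" .
  moreover have "open (\<Union>n. V n \<inter> U n)" using V(1) U(2) by (intro open_UN) auto
  moreover have "A \<subseteq> (\<Union>n. V n \<inter> U n)"
  proof
    fix x assume "x \<in> A"
    moreover have "x \<in> (\<Union>n. U n)" by (simp add: U(5))
    ultimately show "x \<in> (\<Union>n. V n \<inter> U n)" using V(2) by auto
  qed
  ultimately show ?thesis by (intro exI conjI)
qed

section \<open>Outer regular extension of a Borel measure\<close>

lemma radon_extension_mono: "A \<subseteq> B \<Longrightarrow> radon_extension N A \<le> radon_extension N B"
  unfolding radon_extension_def by (intro INF_superset_mono) auto

lemma radon_extension_open:
  assumes "sets N = sets borel" "open V"
  shows "radon_extension N V = emeasure N V"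
  unfolding radon_extension_def using assms
  by (intro antisym INF_lower INF_greatest emeasure_mono) auto

lemma radon_extension_borel:
  fixes N :: "'a::{second_countable_topology, t2_space} measure"
  assumes lc: "locally_compact_space (euclidean :: 'a topology)"
    and sN: "sets N = sets borel" and fin: "\<And>K. compact K \<Longrightarrow> emeasure N K < \<infinity>"
    and A: "A \<in> sets borel"
  shows "radon_extension N A = emeasure N A"
proof (rule antisym)
  show "emeasure N A \<le> radon_extension N A"
    unfolding radon_extension_def using sN by (intro INF_greatest emeasure_mono) auto
  show "radon_extension N A \<le> emeasure N A"
  proof (rule ennreal_le_epsilon)
    fix e :: real assume "0 < e"
    then obtain V where V: "open V" "A \<subseteq> V" "emeasure N (V - A) \<le> ennreal e"
      using borel_outer_approx[OF lc sN fin A] by blast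
    have "radon_extension N A \<le> emeasure N V"
      unfolding radon_extension_def using V by (intro INF_lower) auto
    also have "\<dots> = emeasure N (A \<union> (V - A))"
      using V by (intro arg_cong[where f = "emeasure N"]) auto
    also have "\<dots> \<le> emeasure N A + emeasure N (V - A)"
      using V A sN by (intro emeasure_subadditive) auto
    also have "\<dots> \<le> emeasure N A + ennreal e" by (intro add_left_mono V)
    finally show "radon_extension N A \<le> emeasure N A + ennreal e" .
  qed
qed

text \<open>Countably many open supersets realise the infimum, and their intersection is the hull.
  Hulls turn statements on arbitrary sets into statements on Borel sets, where \<open>N\<close> is
  countably additive.\<close>

lemma radon_extension_hull:
  fixes N :: "'a::{second_countable_topology, t2_space} measure"
  assumes lc: "locally_compact_space (euclidean :: 'a topology)"
    and sN: "sets N = sets borel" and fin: "\<And>K. compact K \<Longrightarrow> emeasure N K < \<infinity>"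
  obtains B where "B \<in> sets borel" "A \<subseteq> B" "emeasure N B = radon_extension N A"
proof -
  let ?S = "emeasure N ` {V. open V \<and> A \<subseteq> V}"
  have "?S \<noteq> {}" by auto
  then obtain f :: "nat \<Rightarrow> ennreal" where f: "range f \<subseteq> ?S" "Inf ?S = (INF i. f i)"
    using ennreal_Inf_countable_INF[of ?S] by blast
  have "\<exists>V. open V \<and> A \<subseteq> V \<and> f i = emeasure N V" for i
    using f(1) by auto
  then obtain V where V: "\<And>i. open (V i)" "\<And>i. A \<subseteq> V i" "\<And>i. f i = emeasure N (V i)" by metis
  show ?thesis
  proof
    show b: "(\<Inter>i. V i) \<in> sets borel" using V by (intro sets.countable_INT) auto
    show sub: "A \<subseteq> (\<Inter>i. V i)" using V by auto
    have "emeasure N (\<Inter>i. V i) \<le> f i" for i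
      unfolding V(3) using V(1) sN by (intro emeasure_mono) auto
    then have "emeasure N (\<Inter>i. V i) \<le> radon_extension N A"
      unfolding radon_extension_def f(2) by (rule INF_greatest)
    moreover have "radon_extension N A \<le> emeasure N (\<Inter>i. V i)"
      using radon_extension_mono[OF sub, of N] radon_extension_borel[OF lc sN fin b] by simp
    ultimately show "emeasure N (\<Inter>i. V i) = radon_extension N A" by (rule antisym)
  qed
qed

text \<open>Subadditivity and Caratheodory's condition are inherited from \<open>N\<close> through
  hulls; inner regularity on open sets comes from their compact exhaustion.\<close>

theorem radon_measure_radon_extension:
  fixes N :: "'a::{second_countable_topology, t2_space} measure"
  assumes lc: "locally_compact_space (euclidean :: 'a topology)"
    and sN: "sets N = sets borel" and fin: "\<And>K. compact K \<Longrightarrow> emeasure N K < \<infinity>"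
  shows "radon_measure (radon_extension N)"
proof -
  have ext: "radon_extension N A = emeasure N A" if "A \<in> sets borel" for A
    by (rule radon_extension_borel[OF lc sN fin that])
  have om: "outer_measure_space UNIV (radon_extension N)"
    unfolding outer_measure_space_def positive_def increasing_def countably_subadditive_def
  proof (intro conjI ballI allI impI)
    show "radon_extension N {} = 0" by (simp add: ext)
    fix A :: "nat \<Rightarrow> 'a set"
    have "\<exists>B. B \<in> sets borel \<and> A i \<subseteq> B \<and> emeasure N B = radon_extension N (A i)" for i
      using radon_extension_hull[OF lc sN fin, of "A i"] by metis
    then obtain B where B: "\<And>i. B i \<in> sets borel" "\<And>i. A i \<subseteq> B i"
      "\<And>i. emeasure N (B i) = radon_extension N (A i)" by metis
    have bB: "(\<Union>i. B i) \<in> sets borel" using B by auto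
    have "radon_extension N (\<Union>i. A i) \<le> radon_extension N (\<Union>i. B i)"
      using B by (intro radon_extension_mono UN_mono) auto
    also have "\<dots> = emeasure N (\<Union>i. B i)" by (rule ext[OF bB])
    also have "\<dots> \<le> (\<Sum>i. emeasure N (B i))"
      using B sN by (intro emeasure_subadditive_countably) auto
    finally show "radon_extension N (\<Union>i. A i) \<le> (\<Sum>i. radon_extension N (A i))" by (simp add: B)
  qed (auto intro: radon_extension_mono)
  have car: "W \<in> caratheodory_sets (radon_extension N)" if "open W" for W
    unfolding caratheodory_sets_iff
  proof (intro allI antisym)
    fix S
    have "radon_extension N ((W \<inter> S) \<union> (- W \<inter> S)) \<le> radon_extension N (W \<inter> S) + radon_extension N (- W \<inter> S)"
      by (rule outer_measure_Un[OF om])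
    then show "radon_extension N S \<le> radon_extension N (W \<inter> S) + radon_extension N (- W \<inter> S)"
      by (simp add: Int_Un_distrib2[symmetric])
    \<comment> \<open>A Borel hull of \<open>S\<close> is split by \<open>W\<close> without loss,
      and its two pieces dominate those of \<open>S\<close>.\<close>
    obtain B where B: "B \<in> sets borel" "S \<subseteq> B" "emeasure N B = radon_extension N S"
      using radon_extension_hull[OF lc sN fin] by blast
    have bW: "W \<inter> B \<in> sets borel" "- W \<inter> B \<in> sets borel" using B(1) that by auto
    have "radon_extension N (W \<inter> S) + radon_extension N (- W \<inter> S)
        \<le> radon_extension N (W \<inter> B) + radon_extension N (- W \<inter> B)"
      using B(2) by (intro add_mono radon_extension_mono) auto
    also have "\<dots> = emeasure N (W \<inter> B) + emeasure N (- W \<inter> B)" using bW by (simp add: ext)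
    also have "\<dots> = emeasure N ((W \<inter> B) \<union> (- W \<inter> B))"
      using bW sN by (intro plus_emeasure) auto
    also have "(W \<inter> B) \<union> (- W \<inter> B) = B" by auto
    finally show "radon_extension N (W \<inter> S) + radon_extension N (- W \<inter> S) \<le> radon_extension N S"
      by (simp add: B)
  qed
  have bK: "K \<in> sets borel" if "compact K" for K :: "'a set"
    using that by (intro borel_closed compact_imp_closed)
  have inner: "radon_extension N V = (SUP K\<in>{K. compact K \<and> K \<subseteq> V}. radon_extension N K)" if V: "open V" for V
  proof (rule antisym)
    obtain K :: "nat \<Rightarrow> 'a set" where K: "incseq K" "\<And>n. compact (K n)" "V = (\<Union>n. K n)"
      using open_Union_compact[OF lc V] by blast
    have "radon_extension N V = emeasure N (\<Union>n. K n)" using V K(3) by (simp add: ext)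
    also have "\<dots> = (SUP n. emeasure N (K n))"
      using K(1) bK[OF K(2)] sN by (intro SUP_emeasure_incseq[symmetric]) auto
    also have "\<dots> \<le> (SUP K\<in>{K. compact K \<and> K \<subseteq> V}. radon_extension N K)"
    proof (rule SUP_least)
      fix n
      have "emeasure N (K n) = radon_extension N (K n)" using ext[OF bK[OF K(2)[of n]]] by simp
      also have "\<dots> \<le> (SUP K\<in>{K. compact K \<and> K \<subseteq> V}. radon_extension N K)"
        using K by (intro SUP_upper) auto
      finally show "emeasure N (K n) \<le> (SUP K\<in>{K. compact K \<and> K \<subseteq> V}. radon_extension N K)" .
    qed
    finally show "radon_extension N V \<le> (SUP K\<in>{K. compact K \<and> K \<subseteq> V}. radon_extension N K)" .
    show "(SUP K\<in>{K. compact K \<and> K \<subseteq> V}. radon_extension N K) \<le> radon_extension N V"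
      by (intro SUP_least radon_extension_mono) auto
  qed
  have outer: "radon_extension N A = (INF V\<in>{V. open V \<and> A \<subseteq> V}. radon_extension N V)" for A
    unfolding radon_extension_def[of N A]
    by (intro INF_cong) (auto simp: radon_extension_open[OF sN])
  have "radon_extension N K < \<infinity>" if "compact K" for K
    using fin[OF that] bK[OF that] by (simp add: ext)
  then show ?thesis
    unfolding radon_measure_def using om car inner outer by (intro conjI allI impI)
qed

text \<open>Together with \<open>borel_part_radon_extension\<close> this makes Radon measures and
  locally finite Borel measures correspond one to one.\<close>

lemma radon_extension_borel_part:
  assumes "radon_measure \<phi>"
  shows "radon_extension (borel_part \<phi>) = \<phi>"
proof
  fix A show "radon_extension (borel_part \<phi>) A = \<phi> A"
    unfolding radon_outer_regular[OF assms, of A] radon_extension_def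
    by (intro INF_cong) (auto simp: emeasure_borel_part[OF assms])
qed

lemma borel_part_radon_extension:
  fixes N :: "'a::{second_countable_topology, t2_space} measure"
  assumes lc: "locally_compact_space (euclidean :: 'a topology)"
    and sN: "sets N = sets borel" and fin: "\<And>K. compact K \<Longrightarrow> emeasure N K < \<infinity>"
  shows "borel_part (radon_extension N) = N"
proof (rule measure_eqI)
  fix A assume "A \<in> sets (borel_part (radon_extension N))"
  then show "emeasure (borel_part (radon_extension N)) A = emeasure N A"
    using emeasure_borel_part[OF radon_measure_radon_extension[OF lc sN fin]]
      radon_extension_borel[OF lc sN fin] by simp
qed (simp add: sN)

lemma borel_part_finite_compact:
  fixes \<phi> :: "'a::t2_space set \<Rightarrow> ennreal"
  assumes "radon_measure \<phi>" "compact K"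
  shows "emeasure (borel_part \<phi>) K < \<infinity>"
  using radon_finite_compact[OF assms] assms
  by (simp add: emeasure_borel_part borel_closed compact_imp_closed)

lemma radon_borel_hull:
  fixes \<phi> :: "'a::{second_countable_topology, t2_space} set \<Rightarrow> ennreal"
  assumes lc: "locally_compact_space (euclidean :: 'a topology)" and "radon_measure \<phi>"
  obtains B where "B \<in> sets borel" "A \<subseteq> B" "\<phi> B = \<phi> A"
  using radon_extension_hull[OF lc sets_borel_part borel_part_finite_compact[OF assms(2)], of A]
  by (metis assms(2) radon_extension_borel_part emeasure_borel_part)

section \<open>Push-forward and measurable hulls\<close>

lemma push_forward_fst: "push_forward fst \<phi> A = \<phi> (A \<times> UNIV)"
  unfolding push_forward_def by (rule arg_cong[of _ _ \<phi>]) auto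

text \<open>Outer regularity is the delicate point. As \<open>Y\<close> need not be compact, an open
  set containing \<open>A \<times> UNIV\<close> need not contain an open tube around it, and a Borel
  tube takes its place.\<close>

theorem radon_measure_push_forward_fst:
  fixes \<Gamma> :: "('a::{second_countable_topology, t2_space} \<times> 'b::{second_countable_topology, t2_space}) set \<Rightarrow> ennreal"
  assumes lc: "locally_compact_space (euclidean :: 'a topology)"
      "locally_compact_space (euclidean :: 'b topology)"
    and \<Gamma>: "radon_measure \<Gamma>"
    and fin: "\<And>K :: 'a set. compact K \<Longrightarrow> \<Gamma> (K \<times> UNIV) < \<infinity>"
  shows "radon_measure (push_forward fst \<Gamma>)"
proof -
  note lcp = locally_compact_space_euclidean_prod[OF lc]
  note mono = outer_measure_mono[OF radon_outer_measure[OF \<Gamma>]]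
  let ?N = "distr (borel_part \<Gamma>) borel fst"
  have sN: "sets ?N = sets borel" by simp
  have meas: "fst \<in> measurable (borel_part \<Gamma>) (borel :: 'a measure)"
    by (simp add: measurable_cong_sets[OF sets_borel_part refl] borel_measurable_continuous_onI continuous_on_fst)
  have em: "emeasure ?N E = \<Gamma> (E \<times> UNIV)" if "E \<in> sets borel" for E
  proof -
    have "fst -` E = E \<times> (UNIV :: 'b set)" by auto
    moreover have "fst -` E \<inter> space (borel_part \<Gamma>) \<in> sets (borel_part \<Gamma>)"
      using meas that by (rule measurable_sets)
    ultimately show ?thesis
      using meas that by (simp add: emeasure_distr emeasure_borel_part[OF \<Gamma>])
  qed
  have finN: "emeasure ?N K < \<infinity>" if "compact K" for K
    using fin[OF that] that by (simp add: em borel_closed compact_imp_closed)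
  have "push_forward fst \<Gamma> A = radon_extension ?N A" for A
  proof (rule antisym)
    show "push_forward fst \<Gamma> A \<le> radon_extension ?N A"
      unfolding radon_extension_def push_forward_fst
      by (intro INF_greatest) (auto simp: em intro!: mono)
    show "radon_extension ?N A \<le> push_forward fst \<Gamma> A"
      unfolding push_forward_fst radon_outer_regular[OF \<Gamma>, of "A \<times> UNIV"]
    proof (rule INF_greatest, clarify)
      fix U :: "('a \<times> 'b) set" assume U: "open U" "A \<times> UNIV \<subseteq> U"
      obtain K where K: "\<And>n. compact (K n)" "- U = (\<Union>n :: nat. K n)"
        using closed_Union_compact[OF lcp, of "- U"] U(1) by (metis closed_Compl)
      \<comment> \<open>\<open>E\<close> consists of the points whose entire fibre lies in
        \<open>U\<close>. It may fail to be open, but it is Borel, and there the extension of the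
        marginal agrees with the marginal itself.\<close>
      define E where "E = - (fst ` (- U))"
      have "compact (fst ` K n)" for n
        using K(1) by (intro compact_continuous_image continuous_on_fst continuous_on_id)
      then have "(\<Union>n. fst ` K n) \<in> sets borel"
        by (intro sets.countable_UN) (auto intro: borel_closed compact_imp_closed)
      then have bE: "E \<in> sets borel"
        unfolding E_def K(2) by (metis image_UN borel_comp)
      have AE: "A \<subseteq> E" and EU: "E \<times> UNIV \<subseteq> U" using U(2) by (force simp: E_def)+
      have "radon_extension ?N A \<le> radon_extension ?N E" by (rule radon_extension_mono[OF AE])
      also have "\<dots> = emeasure ?N E" by (rule radon_extension_borel[OF lc(1) sN finN bE])
      also have "\<dots> = \<Gamma> (E \<times> UNIV)" by (rule em[OF bE])
      also have "\<dots> \<le> \<Gamma> U" by (rule mono[OF EU])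
      finally show "radon_extension ?N A \<le> \<Gamma> U" .
    qed
  qed
  then have "push_forward fst \<Gamma> = radon_extension ?N" by (rule ext)
  then show ?thesis using radon_measure_radon_extension[OF lc(1) sN finN] by simp
qed

section \<open>Sigma-finiteness and Borel hulls of measurable sets\<close>

lemma radon_sigma_finite:
  fixes \<phi> :: "'a::{second_countable_topology, t2_space} set \<Rightarrow> ennreal"
  assumes lc: "locally_compact_space (euclidean :: 'a topology)" and R: "radon_measure \<phi>"
  shows "sigma_finite_measure (borel_part \<phi>)" "sigma_finite_measure (measure_of_outer \<phi>)"
proof -
  obtain K :: "nat \<Rightarrow> 'a set" where K: "\<And>n. compact (K n)" "UNIV = (\<Union>n. K n)"
    using open_Union_compact[OF lc open_UNIV] by metis
  have b: "K n \<in> sets (borel_part \<phi>)" for n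
    using K(1) by (simp add: borel_closed compact_imp_closed)
  have "emeasure (borel_part \<phi>) (K n) \<noteq> \<infinity>" for n
    using borel_part_finite_compact[OF R K(1)[of n]] by simp
  with b K(2) show "sigma_finite_measure (borel_part \<phi>)"
    by (intro sigma_finite_measure.intro exI[of _ "range K"]) auto
  have "emeasure (measure_of_outer \<phi>) (K n) \<noteq> \<infinity>" for n
    using borel_part_finite_compact[OF R K(1)[of n]] borel_part_subalgebra(2)[OF R b[of n]] by simp
  moreover have "K n \<in> sets (measure_of_outer \<phi>)" for n
    using b borel_part_subalgebra(1)[OF R] by blast
  ultimately show "sigma_finite_measure (measure_of_outer \<phi>)"
    using K(2) by (intro sigma_finite_measure.intro exI[of _ "range K"]) auto
qed

text \<open>That a hull of equal mass has a null remainder follows by subtraction, which requires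
  finite mass. So hulls are taken of the pieces \<open>A \<inter> K n\<close>, and the countably
  many null remainders are united.\<close>

lemma caratheodory_borel_hull:
  fixes \<phi> :: "'a::{second_countable_topology, t2_space} set \<Rightarrow> ennreal"
  assumes lc: "locally_compact_space (euclidean :: 'a topology)" and R: "radon_measure \<phi>"
    and A: "A \<in> caratheodory_sets \<phi>"
  obtains B where "B \<in> sets borel" "A \<subseteq> B" "\<phi> (B - A) = 0"
proof -
  note om = radon_outer_measure[OF R]
  obtain K :: "nat \<Rightarrow> 'a set" where K: "\<And>n. compact (K n)" "UNIV = (\<Union>n. K n)"
    using open_Union_compact[OF lc open_UNIV] by metis
  have "\<exists>B. B \<in> sets borel \<and> A \<inter> K n \<subseteq> B \<and> \<phi> B = \<phi> (A \<inter> K n)" for n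
    using radon_borel_hull[OF lc R, of "A \<inter> K n"] by metis
  then obtain B where B: "\<And>n. B n \<in> sets borel" "\<And>n. A \<inter> K n \<subseteq> B n" "\<And>n. \<phi> (B n) = \<phi> (A \<inter> K n)"
    by metis
  have "\<phi> (B n - (A \<inter> K n)) = 0" for n
  proof -
    have "K n \<in> caratheodory_sets \<phi>"
      using radon_borel_caratheodory[OF R] K(1)[of n] by (auto intro: borel_closed compact_imp_closed)
    then have AK: "A \<inter> K n \<in> caratheodory_sets \<phi>"
      using A unfolding sets_measure_of_outer[OF om, symmetric] by (rule sets.Int[rotated])
    then have "\<phi> ((A \<inter> K n) \<inter> B n) + \<phi> (- (A \<inter> K n) \<inter> B n) = \<phi> (B n)"
      unfolding caratheodory_sets_iff by blast
    moreover have "(A \<inter> K n) \<inter> B n = A \<inter> K n" "- (A \<inter> K n) \<inter> B n = B n - (A \<inter> K n)"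
      using B(2)[of n] by auto
    ultimately have "\<phi> (A \<inter> K n) + \<phi> (B n - (A \<inter> K n)) = \<phi> (A \<inter> K n) + 0" using B(3)[of n] by simp
    moreover have "\<phi> (A \<inter> K n) \<noteq> \<infinity>"
      using radon_finite_compact[OF R K(1)[of n]] outer_measure_mono[OF om, of "A \<inter> K n" "K n"]
      by (auto simp: top_unique)
    ultimately show ?thesis by (metis ennreal_add_left_cancel infinity_ennreal_def)
  qed
  then have "(\<Union>n. B n - (A \<inter> K n)) \<in> null_sets (measure_of_outer \<phi>)"
    by (intro null_sets_UN) (simp add: null_iff_null_sets[OF om])
  then have "\<phi> (\<Union>n. B n - (A \<inter> K n)) = 0" by (simp add: null_iff_null_sets[OF om])
  moreover have "(\<Union>n. B n) - A \<subseteq> (\<Union>n. B n - (A \<inter> K n))" by auto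
  ultimately have "\<phi> ((\<Union>n. B n) - A) = 0"
    using outer_measure_mono[OF om] by (metis le_zero_eq)
  moreover have "A \<subseteq> (\<Union>n. B n)"
  proof
    fix x assume x: "x \<in> A"
    have "x \<in> (\<Union>n. K n)" using K(2) by blast
    with x B(2) show "x \<in> (\<Union>n. B n)" by auto
  qed
  moreover have "(\<Union>n. B n) \<in> sets borel" using B by auto
  ultimately show ?thesis using that by simp
qed

text \<open>Uniqueness of densities asks for all measurable test sets; each of them is Borel up to a
  null set.\<close>

lemma AE_eq_by_borel_integrals:
  fixes \<phi> :: "'a::{second_countable_topology, t2_space} set \<Rightarrow> ennreal"
  assumes lc: "locally_compact_space (euclidean :: 'a topology)" and R: "radon_measure \<phi>"
    and F: "F \<in> borel_measurable (measure_of_outer \<phi>)" "F' \<in> borel_measurable (measure_of_outer \<phi>)"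
    and eq: "\<And>E. E \<in> sets borel \<Longrightarrow>
      (\<integral>\<^sup>+x. F x * indicator E x \<partial>measure_of_outer \<phi>) = (\<integral>\<^sup>+x. F' x * indicator E x \<partial>measure_of_outer \<phi>)"
  shows "AE x in measure_of_outer \<phi>. F x = F' x"
proof (rule sigma_finite_measure.density_unique[OF radon_sigma_finite(2)[OF lc R] F], rule measure_eqI)
  note om = radon_outer_measure[OF R]
  fix A assume "A \<in> sets (density (measure_of_outer \<phi>) F)"
  then have A: "A \<in> sets (measure_of_outer \<phi>)" by simp
  then obtain B where B: "B \<in> sets borel" "A \<subseteq> B" "\<phi> (B - A) = 0"
    using caratheodory_borel_hull[OF lc R] by (metis om sets_measure_of_outer)
  have "AE x in measure_of_outer \<phi>. x \<notin> B - A"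
    using B(3) by (simp add: AE_measure_of_outer_iff[OF om] set_diff_eq)
  then have "AE x in measure_of_outer \<phi>. indicator A x = (indicator B x :: ennreal)"
    by (rule AE_mp) (use B(2) in \<open>auto simp: indicator_def intro!: AE_I2\<close>)
  then have *: "(\<integral>\<^sup>+x. G x * indicator A x \<partial>measure_of_outer \<phi>) = (\<integral>\<^sup>+x. G x * indicator B x \<partial>measure_of_outer \<phi>)" for G
    by (intro nn_integral_cong_AE) auto
  show "emeasure (density (measure_of_outer \<phi>) F) A = emeasure (density (measure_of_outer \<phi>) F') A"
    using A F by (simp add: emeasure_density * eq[OF B(1)])
qed simp

section \<open>Semicontinuity on the space of probability measures\<close>

text \<open>Around each of its points an open set contains a finite intersection of subbasic sets,
  and a countable subbase has only countably many of these. So the open set is a countable union of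
  them.\<close>

lemma openin_generated_countable:
  assumes "countable \<S>" "openin (topology_generated_by \<S>) U" "\<S> \<subseteq> Pow \<Omega>"
  shows "U \<in> sigma_sets \<Omega> \<S>"
proof -
  interpret sigma_algebra \<Omega> "sigma_sets \<Omega> \<S>"
    using assms(3) by (rule sigma_algebra_sigma_sets)
  \<comment> \<open>Empty families are excluded because \<open>\<Inter>{}\<close> is the whole type,
    which may exceed \<open>\<Omega>\<close>.\<close>
  let ?F = "{F. finite F \<and> F \<subseteq> \<S> \<and> F \<noteq> {} \<and> \<Inter>F \<subseteq> U}"
  have "generate_topology_on \<S> U" using assms(2) by (rule openin_topology_generated_by)
  then have "\<forall>x\<in>U. \<exists>F. finite F \<and> F \<subseteq> \<S> \<and> F \<noteq> {} \<and> x \<in> \<Inter>F \<and> \<Inter>F \<subseteq> U"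
  proof induction
    case (Int a b)
    show ?case
    proof
      fix x assume "x \<in> a \<inter> b"
      then obtain F F' where "finite F" "F \<subseteq> \<S>" "F \<noteq> {}" "x \<in> \<Inter>F" "\<Inter>F \<subseteq> a"
        "finite F'" "F' \<subseteq> \<S>" "F' \<noteq> {}" "x \<in> \<Inter>F'" "\<Inter>F' \<subseteq> b"
        using Int.IH by (metis IntD1 IntD2)
      then show "\<exists>F. finite F \<and> F \<subseteq> \<S> \<and> F \<noteq> {} \<and> x \<in> \<Inter>F \<and> \<Inter>F \<subseteq> a \<inter> b"
        by (intro exI[of _ "F \<union> F'"]) auto
    qed
  next
    case (UN K)
    show ?case
    proof
      fix x assume "x \<in> \<Union>K"
      then obtain k where k: "k \<in> K" "x \<in> k" by blast
      then obtain F where "finite F" "F \<subseteq> \<S>" "F \<noteq> {}" "x \<in> \<Inter>F" "\<Inter>F \<subseteq> k"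
        using UN.IH[OF k(1)] by metis
      moreover have "k \<subseteq> \<Union>K" using k(1) by blast
      ultimately show "\<exists>F. finite F \<and> F \<subseteq> \<S> \<and> F \<noteq> {} \<and> x \<in> \<Inter>F \<and> \<Inter>F \<subseteq> \<Union>K"
        by (intro exI[of _ F]) auto
    qed
  next
    case (Basis s)
    then show ?case by (intro ballI exI[of _ "{s}"]) auto
  qed simp
  then have "U = (\<Union>F\<in>?F. \<Inter>F)"
    by (intro equalityI subsetI) (simp, meson, auto)
  moreover have "countable ?F"
    by (rule countable_subset[OF _ countable_Collect_finite_subset[OF assms(1)]]) auto
  moreover have "\<Inter>F \<in> sigma_sets \<Omega> \<S>" if "F \<in> ?F" for F
    using that finite_INT[of F "\<lambda>x. x"] by (auto intro: sigma_sets.Basic)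
  ultimately show ?thesis
    by (metis (no_types, lifting) countable_UN'')
qed

text \<open>Sets \<open>{\<nu>. r < \<nu> B}\<close> control masses only from below, so
  semicontinuity is the natural notion; continuity of an integral is obtained by treating the
  integrand and its negative separately.\<close>

definition lsc_map :: "'a topology \<Rightarrow> ('a \<Rightarrow> real) \<Rightarrow> bool" where
  "lsc_map T F \<longleftrightarrow> (\<forall>a. openin T {x \<in> topspace T. a < F x})"

lemma lsc_map_add:
  assumes "lsc_map T F" "lsc_map T G"
  shows "lsc_map T (\<lambda>x. F x + G x)"
  unfolding lsc_map_def
proof
  fix a
  have "{x \<in> topspace T. a < F x + G x} =
      (\<Union>q. {x \<in> topspace T. q < F x} \<inter> {x \<in> topspace T. a - q < G x})" (is "?L = ?R")
  proof (intro equalityI subsetI)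
    fix x assume x: "x \<in> ?L"
    \<comment> \<open>The witness is the midpoint of \<open>a - G x\<close> and
      \<open>F x\<close>.\<close>
    then have "(F x + a - G x) / 2 < F x" "a - (F x + a - G x) / 2 < G x"
      by (auto simp: field_simps)
    with x show "x \<in> ?R" by blast
  qed auto
  also have "openin T \<dots>"
    using assms by (intro openin_Union) (auto simp: lsc_map_def)
  finally show "openin T ?L" .
qed

lemma lsc_map_const: "lsc_map T (\<lambda>x. c)"
proof -
  have "{x \<in> topspace T. a < c} = (if a < c then topspace T else {})" for a by auto
  then show ?thesis by (simp add: lsc_map_def)
qed

lemma lsc_map_cmult:
  assumes "lsc_map T F" "0 \<le> c"
  shows "lsc_map T (\<lambda>x. c * F x)"
proof (cases "c = 0")
  case True
  then show ?thesis by (simp add: lsc_map_const)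
next
  case False
  with assms(2) have "a < c * F x \<longleftrightarrow> a / c < F x" for a x by (simp add: field_simps)
  with assms(1) show ?thesis by (simp add: lsc_map_def)
qed

lemma lsc_map_sum:
  assumes "finite I" "\<And>i. i \<in> I \<Longrightarrow> lsc_map T (F i)"
  shows "lsc_map T (\<lambda>x. \<Sum>i\<in>I. F i x)"
  using assms by (induction I rule: finite_induct) (auto simp: lsc_map_const lsc_map_add)

lemma lsc_map_uniform_limit:
  assumes "\<And>e. 0 < e \<Longrightarrow> \<exists>G. lsc_map T G \<and> (\<forall>x\<in>topspace T. \<bar>F x - G x\<bar> \<le> e)"
  shows "lsc_map T F"
  unfolding lsc_map_def
proof (intro allI, subst openin_subopen, intro ballI)
  fix a x assume x: "x \<in> {x \<in> topspace T. a < F x}"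
  \<comment> \<open>A third of the gap leaves a strict margin: \<open>G x\<close> is at least
    \<open>a + 2 * e\<close>, and \<open>a + e < G y\<close> forces \<open>a < F y\<close>.\<close>
  define e where "e = (F x - a) / 3"
  with x have "0 < e" by simp
  then obtain G where G: "lsc_map T G" "\<forall>x\<in>topspace T. \<bar>F x - G x\<bar> \<le> e"
    using assms by blast
  have "openin T {x \<in> topspace T. a + e < G x}" using G(1) by (auto simp: lsc_map_def)
  moreover have "F x - G x \<le> e" using bspec[OF G(2)] x by (auto dest!: abs_le_D1)
  then have "a + e < G x" using \<open>0 < e\<close> by (simp add: e_def field_simps)
  moreover have "{x \<in> topspace T. a + e < G x} \<subseteq> {x \<in> topspace T. a < F x}"
  proof
    fix y assume y: "y \<in> {x \<in> topspace T. a + e < G x}"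
    then have "\<bar>F y - G y\<bar> \<le> e" using G(2) by blast
    with y show "y \<in> {x \<in> topspace T. a < F x}" by (auto simp: abs_le_iff)
  qed
  ultimately show "\<exists>S. openin T S \<and> x \<in> S \<and> S \<subseteq> {x \<in> topspace T. a < F x}"
    using x by (intro exI[of _ "{x \<in> topspace T. a + e < G x}"]) auto
qed

lemma lsc_map_openin_vimage:
  assumes "lsc_map T F" "lsc_map T (\<lambda>x. - F x)" "open W"
  shows "openin T {x \<in> topspace T. F x \<in> W}"
proof (subst openin_subopen, intro ballI)
  fix x assume x: "x \<in> {x \<in> topspace T. F x \<in> W}"
  then obtain e where e: "0 < e" "\<And>y. dist y (F x) < e \<Longrightarrow> y \<in> W"
    using assms(3) by (auto simp: open_dist)
  let ?S = "{y \<in> topspace T. F x - e < F y} \<inter> {y \<in> topspace T. - F x - e < - F y}"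
  have "openin T ?S" using assms(1,2) by (auto simp: lsc_map_def)
  moreover have "?S \<subseteq> {x \<in> topspace T. F x \<in> W}"
    using e(2) by (auto simp: dist_real_def abs_less_iff)
  ultimately show "\<exists>S. openin T S \<and> x \<in> S \<and> S \<subseteq> {x \<in> topspace T. F x \<in> W}"
    using x e(1) by (intro exI[of _ ?S]) auto
qed

text \<open>Counting the levels strictly below \<open>t\<close> rounds \<open>t\<close> to a grid
  point at most \<open>d\<close> below it; the cap \<open>Suc n * d\<close> ensures that
  \<open>n\<close> levels suffice.\<close>

lemma staircase_bounds:
  fixes t d :: real
  assumes "0 < d" "0 \<le> t" "t \<le> real (Suc n) * d"
  shows "t - d \<le> (\<Sum>i\<in>{1..n}. d * of_bool (real i * d < t))"
    and "(\<Sum>i\<in>{1..n}. d * of_bool (real i * d < t)) \<le> t"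
proof -
  have "t - d \<le> (\<Sum>i\<in>{1..n}. d * of_bool (real i * d < t)) \<and> (\<Sum>i\<in>{1..n}. d * of_bool (real i * d < t)) \<le> t"
    using assms(3)
  proof (induction n)
    case 0
    with assms show ?case by simp
  next
    case (Suc n)
    show ?case
    proof (cases "t \<le> real (Suc n) * d")
      case True
      with Suc.IH show ?thesis by simp
    next
      case False
      have "real i * d < t" if "i \<in> {1..Suc n}" for i
      proof -
        have "real i * d \<le> real (Suc n) * d" using that \<open>0 < d\<close> by (intro mult_right_mono) auto
        with False show ?thesis by simp
      qed
      then have "(\<Sum>i\<in>{1..Suc n}. d * of_bool (real i * d < t)) = (\<Sum>i\<in>{1..Suc n}. d)"
        by (intro sum.cong) auto
      also have "\<dots> = real (Suc n) * d" by simp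
      finally show ?thesis using False Suc.prems by (simp add: algebra_simps)
    qed
  qed
  then show "t - d \<le> (\<Sum>i\<in>{1..n}. d * of_bool (real i * d < t))"
    and "(\<Sum>i\<in>{1..n}. d * of_bool (real i * d < t)) \<le> t" by auto
qed

lemma prob_radonD:
  assumes "\<nu> \<in> prob_radon"
  shows "radon_measure \<nu>" "prob_space (borel_part \<nu>)"
  using assms by (auto simp: prob_radon_def emeasure_borel_part intro!: prob_spaceI)

text \<open>A staircase within \<open>d\<close> of \<open>u\<close> integrates to a nonnegative
  combination of masses of open superlevel sets, which is semicontinuous. Since all measures have
  mass one, the integrals differ by at most \<open>d\<close>, uniformly in the measure.\<close>

lemma lsc_integral_bounded:
  fixes T :: "('a::topological_space set \<Rightarrow> ennreal) topology"
  assumes T: "topspace T \<subseteq> prob_radon"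
    and lsc: "\<And>V. open V \<Longrightarrow> lsc_map T (\<lambda>\<nu>. measure (borel_part \<nu>) V)"
    and u: "continuous_on UNIV u" "\<And>y. 0 \<le> u y" "\<And>y. u y \<le> B"
  shows "lsc_map T (\<lambda>\<nu>. integral\<^sup>L (borel_part \<nu>) u)"
proof (rule lsc_map_uniform_limit)
  fix d :: real assume "0 < d"
  obtain n where "B / d < real n" using reals_Archimedean2 by blast
  then have n: "B \<le> real (Suc n) * d" using \<open>0 < d\<close> by (simp add: field_simps)
  let ?s = "\<lambda>y. \<Sum>i\<in>{1..n}. d * of_bool (real i * d < u y)"
  let ?V = "\<lambda>i. {y. real i * d < u y}"
  have V: "open (?V i)" for i
    using u(1) open_Collect_less[of "\<lambda>_. real i * d" u] by (auto intro: continuous_on_const)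
  have "lsc_map T (\<lambda>\<nu>. \<Sum>i\<in>{1..n}. d * measure (borel_part \<nu>) (?V i))"
    using \<open>0 < d\<close> by (intro lsc_map_sum lsc_map_cmult lsc V) auto
  moreover have "\<bar>integral\<^sup>L (borel_part \<nu>) u - (\<Sum>i\<in>{1..n}. d * measure (borel_part \<nu>) (?V i))\<bar> \<le> d"
    if "\<nu> \<in> topspace T" for \<nu>
  proof -
    interpret prob_space "borel_part \<nu>" using that T prob_radonD(2) by blast
    have int: "integrable (borel_part \<nu>) u"
      using u by (intro integrable_const_bound[of _ B])
       (auto simp: measurable_cong_sets[OF sets_borel_part refl] intro: borel_measurable_continuous_onI)
    have ind: "integrable (borel_part \<nu>) (\<lambda>y. d * indicator (?V i) y)" for i
      using V by (intro integrable_mult_right integrable_real_indicator) (auto simp: less_top[symmetric])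
    have s: "?s = (\<lambda>y. \<Sum>i\<in>{1..n}. d * indicator (?V i) y)" by (auto simp: indicator_def)
    have ints: "integrable (borel_part \<nu>) ?s" unfolding s by (intro Bochner_Integration.integrable_sum ind)
    have "integral\<^sup>L (borel_part \<nu>) ?s = (\<Sum>i\<in>{1..n}. d * measure (borel_part \<nu>) (?V i))"
      unfolding s by (subst Bochner_Integration.integral_sum[OF ind]) simp
    moreover have "integral\<^sup>L (borel_part \<nu>) (\<lambda>y. u y - d) \<le> integral\<^sup>L (borel_part \<nu>) ?s"
      using u(2,3) n \<open>0 < d\<close> int ints
      by (intro integral_mono staircase_bounds(1)) (auto intro: order_trans)
    moreover have "integral\<^sup>L (borel_part \<nu>) ?s \<le> integral\<^sup>L (borel_part \<nu>) u"
      using u(2,3) n \<open>0 < d\<close> int ints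
      by (intro integral_mono staircase_bounds(2)) (auto intro: order_trans)
    moreover have "integral\<^sup>L (borel_part \<nu>) (\<lambda>y. u y - d) = integral\<^sup>L (borel_part \<nu>) u - d"
      using int prob_space by simp
    ultimately show ?thesis using \<open>0 < d\<close> by linarith
  qed
  ultimately show "\<exists>G. lsc_map T G \<and> (\<forall>\<nu>\<in>topspace T. \<bar>integral\<^sup>L (borel_part \<nu>) u - G \<nu>\<bar> \<le> d)"
    by blast
qed

section \<open>Young functions as measurable kernels\<close>

text \<open>The zero measure off the domain makes the kernel total and reproduces the default value
  in \<open>young_integral\<close>. It is also why subprobability kernels appear instead of
  probability kernels.\<close>

definition young_kernel ::
  "('a \<rightharpoonup> ('b::topological_space set \<Rightarrow> ennreal)) \<Rightarrow> 'a \<Rightarrow> 'b measure" where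
  "young_kernel f x = (case f x of None \<Rightarrow> null_measure borel | Some \<nu> \<Rightarrow> borel_part \<nu>)"

lemma sets_young_kernel [simp]: "sets (young_kernel f x) = sets borel"
  by (simp add: young_kernel_def split: option.split)

lemma space_young_kernel [simp]: "space (young_kernel f x) = UNIV"
  by (simp add: young_kernel_def split: option.split)

lemma subprob_space_young_kernel:
  assumes "ran f \<subseteq> prob_radon"
  shows "subprob_space (young_kernel f x)"
proof (cases "f x")
  case None
  then show ?thesis by (auto simp: young_kernel_def intro!: subprob_spaceI)
next
  case (Some \<nu>)
  then have "\<nu> \<in> prob_radon" using assms ranI by fast
  then show ?thesis
    using Some prob_space_imp_subprob_space[OF prob_radonD(2)] by (simp add: young_kernel_def)
qed

text \<open>Open sets form an intersection stable generator, and their masses are countable suprema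
  of integrals of fixed test functions. The subbasic open sets of \<open>prob_radon_topology\<close>
  say exactly that these integrals are measurable in \<open>x\<close>.\<close>

lemma young_function_kernel_measurable:
  fixes f :: "'a \<rightharpoonup> ('b::{second_countable_topology, t2_space} set \<Rightarrow> ennreal)"
  assumes lc: "locally_compact_space (euclidean :: 'b topology)"
    and om: "outer_measure_space UNIV \<mu>" and f: "young_function \<mu> f"
  shows "young_kernel f \<in> measurable (measure_of_outer \<mu>) (subprob_algebra borel)"
proof (rule measurable_subprob_algebra_generated[where G = "{S. open S}" and \<Omega> = UNIV])
  let ?M = "measure_of_outer \<mu>"
  have dom0: "- dom f \<in> sets ?M" and ran: "ran f \<subseteq> prob_radon"
    using f caratheodory_null[OF om] by (auto simp: young_function_def sets_measure_of_outer[OF om])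
  have ranD: "\<nu> \<in> prob_radon" if "f x = Some \<nu>" for x \<nu>
    using ranI[of f x, OF that] ran by blast
  show "sets (borel :: 'b measure) = sigma_sets UNIV {S. open S}" by (simp add: borel_def)
  show "subprob_space (young_kernel f x)" for x by (rule subprob_space_young_kernel[OF ran])
  have open_meas: "(\<lambda>x. emeasure (young_kernel f x) V) \<in> borel_measurable ?M" if V: "open V" for V :: "'b set"
  proof -
    obtain k :: "nat \<Rightarrow> 'b \<Rightarrow> real" where k: "\<And>n. k n \<in> compactly_supported"
      "\<And>\<phi>. radon_measure \<phi> \<Longrightarrow> \<phi> V = (SUP n. ennreal (outer_integral \<phi> (k n)))"
      using cutoff_sequence[OF lc V] by blast
    define g where "g n x = (case f x of None \<Rightarrow> 0 | Some \<nu> \<Rightarrow> outer_integral \<nu> (k n))" for n x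
    have "g n \<in> borel_measurable ?M" for n
    proof (rule borel_measurableI)
      fix W :: "real set" assume W: "open W"
      let ?U = "{\<nu> \<in> prob_radon. outer_integral \<nu> (k n) \<in> W}"
      have "openin prob_radon_topology ?U"
        unfolding prob_radon_topology_def
        using W k(1) by (intro topology_generated_by_Basis) blast
      then have "f -` (Some ` ?U) \<in> sets ?M"
        using f by (simp add: young_function_def sets_measure_of_outer[OF om])
      \<comment> \<open>Off the domain \<open>g n\<close> is \<open>0\<close>, so those points
        belong to the preimage exactly when \<open>W\<close> contains \<open>0\<close>.\<close>
      moreover have "g n -` W \<inter> space ?M = f -` (Some ` ?U) \<union> (if 0 \<in> W then - dom f else {})"
        using ranD by (auto simp: g_def dom_def image_iff split: option.splits)
      ultimately show "g n -` W \<inter> space ?M \<in> sets ?M" using dom0 by auto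
    qed
    then have "(\<lambda>x. SUP n. ennreal (g n x)) \<in> borel_measurable ?M" by measurable
    moreover have "emeasure (young_kernel f x) V = (SUP n. ennreal (g n x))" for x
    proof (cases "f x")
      case None
      then show ?thesis by (simp add: young_kernel_def g_def)
    next
      case (Some \<nu>)
      then have "radon_measure \<nu>" by (intro prob_radonD(1) ranD)
      then have "emeasure (borel_part \<nu>) V = (SUP n. ennreal (outer_integral \<nu> (k n)))"
        using V by (subst emeasure_borel_part) (auto intro: k(2))
      with Some show ?thesis by (simp add: young_kernel_def g_def)
    qed
    ultimately show ?thesis by simp
  qed
  then show "(\<lambda>x. emeasure (young_kernel f x) V) \<in> borel_measurable ?M" if "V \<in> {S. open S}" for V
    using that by simp
  show "(\<lambda>x. emeasure (young_kernel f x) UNIV) \<in> borel_measurable ?M"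
    by (rule open_meas[OF open_UNIV])
qed (auto simp: Int_stable_def)

text \<open>Measurable preimages of the defining subbasic sets would not settle arbitrary unions. In
  the finer topology \<open>T\<close> every open set is a countable combination of sets whose
  preimages are easily measured.\<close>

lemma prob_radon_openin_sigma:
  obtains \<B> :: "'b::second_countable_topology set set" where "\<forall>B\<in>\<B>. open B"
    "\<forall>U. openin prob_radon_topology U \<longrightarrow>
      U \<in> sigma_sets prob_radon {{\<nu> \<in> prob_radon. of_rat r < measure (borel_part \<nu>) B} | r B. B \<in> \<B>}"
proof -
  obtain \<B>0 :: "'b set set" where B0: "countable \<B>0" "topological_basis \<B>0"
    using ex_countable_basis by blast
  \<comment> \<open>Finite unions of base sets increase to any given open set, so continuity from
    below reduces its mass to masses of members of \<open>\<B>\<close>. The added \<open>{}\<close>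
    takes care of an empty cover.\<close>
  define \<B> where "\<B> = Union ` {F. finite F \<and> F \<subseteq> insert {} \<B>0}"
  have cB: "countable \<B>"
    unfolding \<B>_def using B0(1)
    by (intro countable_image countable_Collect_finite_subset) auto
  have oB: "open B" if "B \<in> \<B>" for B
    using that topological_basis_open[OF B0(2)] unfolding \<B>_def by auto
  define \<S> where "\<S> = {{\<nu> \<in> prob_radon. of_rat r < measure (borel_part \<nu>) B} | r B. B \<in> \<B>}"
  define T where "T = topology_generated_by \<S>"
  have "\<S> = (\<lambda>(r, B). {\<nu> \<in> prob_radon. of_rat r < measure (borel_part \<nu>) B}) ` (UNIV \<times> \<B>)"
    unfolding \<S>_def by auto
  then have cS: "countable \<S>" using cB by (auto intro!: countable_image countable_SIGMA)
  \<comment> \<open>Every mass exceeds the level \<open>-1\<close>, so \<open>prob_radon\<close>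
    itself is subbasic and is the carrier of \<open>T\<close>.\<close>
  have "{} \<in> \<B>" unfolding \<B>_def by (auto intro!: image_eqI[of _ _ "{}"])
  then have "{\<nu> \<in> prob_radon. of_rat (-1) < measure (borel_part \<nu>) ({} :: 'b set)} \<in> \<S>"
    unfolding \<S>_def by blast
  moreover have "{\<nu> \<in> prob_radon. of_rat (-1) < measure (borel_part \<nu>) ({} :: 'b set)} = prob_radon" by auto
  ultimately have top: "topspace T = prob_radon"
    unfolding T_def by (auto simp: \<S>_def)
  have lsc: "lsc_map T (\<lambda>\<nu>. measure (borel_part \<nu>) V)" if V: "open V" for V
    unfolding lsc_map_def
  proof (intro allI, subst openin_subopen, intro ballI)
    fix a \<nu> assume "\<nu> \<in> {\<nu> \<in> topspace T. a < measure (borel_part \<nu>) V}"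
    then have \<nu>: "\<nu> \<in> prob_radon" "a < measure (borel_part \<nu>) V" by (auto simp: top)
    interpret prob_space "borel_part \<nu>" by (rule prob_radonD(2)[OF \<nu>(1)])
    obtain C where C: "C \<subseteq> \<B>0" "\<Union>C = V"
      using B0(2) V by (auto simp: topological_basis_def)
    define g where "g = from_nat_into (insert {} C)"
    have g: "range g = insert {} C"
      unfolding g_def using countable_subset[OF C(1) B0(1)] by (intro range_from_nat_into) auto
    define D where "D n = \<Union>(g ` {..n})" for n
    have DB: "D n \<in> \<B>" for n
      unfolding \<B>_def D_def using g C(1) by (intro imageI) auto
    have "\<Union>(range g) = V" unfolding g using C(2) by simp
    then have DV: "(\<Union>n. D n) = V" unfolding D_def by auto
    have "incseq D" unfolding D_def by (intro monoI UN_mono Union_mono image_mono) auto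
    then have "(\<lambda>n. measure (borel_part \<nu>) (D n)) \<longlonglongrightarrow> measure (borel_part \<nu>) (\<Union>n. D n)"
      using oB[OF DB] by (intro finite_Lim_measure_incseq) auto
    then have "eventually (\<lambda>n. a < measure (borel_part \<nu>) (D n)) sequentially"
      using \<nu>(2) unfolding DV by (intro order_tendstoD)
    then obtain n where n: "a < measure (borel_part \<nu>) (D n)" by (auto simp: eventually_sequentially)
    then obtain r where r: "a < of_rat r" "of_rat r < measure (borel_part \<nu>) (D n)"
      using of_rat_dense by blast
    let ?S = "{\<nu> \<in> prob_radon. of_rat r < measure (borel_part \<nu>) (D n)}"
    have "openin T ?S"
      unfolding T_def using DB by (intro topology_generated_by_Basis) (auto simp: \<S>_def)
    moreover have "?S \<subseteq> {\<nu> \<in> topspace T. a < measure (borel_part \<nu>) V}"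
    proof
      fix \<nu>' assume \<nu>': "\<nu>' \<in> ?S"
      then interpret \<nu>': prob_space "borel_part \<nu>'" by (auto intro: prob_radonD)
      have "measure (borel_part \<nu>') (D n) \<le> measure (borel_part \<nu>') V"
        using V DV by (intro \<nu>'.finite_measure_mono) auto
      with \<nu>' r(1) show "\<nu>' \<in> {\<nu> \<in> topspace T. a < measure (borel_part \<nu>) V}" by (auto simp: top)
    qed
    ultimately show "\<exists>S. openin T S \<and> \<nu> \<in> S \<and> S \<subseteq> {\<nu> \<in> topspace T. a < measure (borel_part \<nu>) V}"
      using \<nu>(1) r(2) by (intro exI[of _ ?S]) auto
  qed
  have sub: "openin T {\<nu> \<in> prob_radon. outer_integral \<nu> k \<in> W}"
    if k: "k \<in> compactly_supported" and W: "open W" for k :: "'b \<Rightarrow> real" and W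
  proof -
    have kc: "continuous_on UNIV k" and km: "k \<in> borel_measurable borel"
      using compactly_supportedD[OF k] by auto
    obtain B K where "0 \<le> B" "\<And>x. \<bar>k x\<bar> \<le> B * indicator K x"
      using compactly_supportedD(3)[OF k] by blast
    moreover have "B * indicator K x \<le> B" for x using \<open>0 \<le> B\<close> by (simp add: indicator_def)
    ultimately have B: "\<bar>k x\<bar> \<le> B" for x by (metis order_trans)
    \<comment> \<open>Shifting by the bound \<open>B\<close> makes \<open>B + k\<close> and
      \<open>B - k\<close> nonnegative, so both integrals are semicontinuous. Mass one removes the
      shift, leaving semicontinuity of the integral of \<open>k\<close> and of its negative.\<close>
    have B1: "0 \<le> B + k x" "0 \<le> B - k x" and B2: "B + k x \<le> 2 * B" "B - k x \<le> 2 * B" for x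
      using B[of x] by (auto simp: abs_le_iff)
    have "lsc_map T (\<lambda>\<nu>. integral\<^sup>L (borel_part \<nu>) (\<lambda>y. B + k y) + (- B))"
      using kc B1 B2
      by (intro lsc_map_add lsc_map_const lsc_integral_bounded[where B = "2 * B"] lsc continuous_intros)
        (auto simp: top)
    then have 1: "lsc_map T (\<lambda>\<nu>. integral\<^sup>L (borel_part \<nu>) (\<lambda>y. B + k y) - B)" by simp
    have "lsc_map T (\<lambda>\<nu>. integral\<^sup>L (borel_part \<nu>) (\<lambda>y. B - k y) + (- B))"
      using kc B1 B2
      by (intro lsc_map_add lsc_map_const lsc_integral_bounded[where B = "2 * B"] lsc continuous_intros)
        (auto simp: top)
    then have 2: "lsc_map T (\<lambda>\<nu>. integral\<^sup>L (borel_part \<nu>) (\<lambda>y. B - k y) - B)" by simp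
    have eqs: "integral\<^sup>L (borel_part \<nu>) (\<lambda>y. B + k y) - B = outer_integral \<nu> k"
      "integral\<^sup>L (borel_part \<nu>) (\<lambda>y. B - k y) - B = - outer_integral \<nu> k" if "\<nu> \<in> prob_radon" for \<nu>
    proof -
      interpret prob_space "borel_part \<nu>" by (rule prob_radonD(2)[OF that])
      have "integrable (borel_part \<nu>) k"
        using B km by (intro integrable_const_bound[of _ B])
          (auto simp: measurable_cong_sets[OF sets_borel_part refl])
      then show "integral\<^sup>L (borel_part \<nu>) (\<lambda>y. B + k y) - B = outer_integral \<nu> k"
      "integral\<^sup>L (borel_part \<nu>) (\<lambda>y. B - k y) - B = - outer_integral \<nu> k"
        using prob_space by (simp_all add: outer_integral_borel[OF prob_radonD(1)[OF that] km])
    qed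
    have cong: "lsc_map T F \<longleftrightarrow> lsc_map T G" if "\<And>\<nu>. \<nu> \<in> topspace T \<Longrightarrow> F \<nu> = G \<nu>" for F G
      unfolding lsc_map_def using that by (metis (no_types, lifting) Collect_cong)
    have 3: "lsc_map T (\<lambda>\<nu>. outer_integral \<nu> k)"
      by (rule iffD1[OF cong 1]) (simp add: top eqs)
    have 4: "lsc_map T (\<lambda>\<nu>. - outer_integral \<nu> k)"
      by (rule iffD1[OF cong 2]) (simp add: top eqs)
    from lsc_map_openin_vimage[OF 3 4 W] show ?thesis by (simp add: top)
  qed
  have "openin T U" if "openin prob_radon_topology U" for U
    using openin_topology_generated_by[OF that[unfolded prob_radon_topology_def]]
    by (rule generate_topology_on_coarsest[rotated 2]) (auto intro: sub)
  then have sig: "U \<in> sigma_sets prob_radon \<S>" if "openin prob_radon_topology U" for U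
    using that unfolding T_def by (intro openin_generated_countable[OF cS]) (auto simp: \<S>_def)
  show ?thesis
  proof (rule that)
    show "\<forall>B\<in>\<B>. open B" using oB by (rule ballI)
    show "\<forall>U. openin prob_radon_topology U \<longrightarrow>
      U \<in> sigma_sets prob_radon {{\<nu> \<in> prob_radon. of_rat r < measure (borel_part \<nu>) B} | r B. B \<in> \<B>}"
      using sig unfolding \<S>_def by (intro allI impI)
  qed
qed

text \<open>The sets with measurable preimage form a sigma-algebra on \<open>prob_radon\<close>.
  Complements there become differences inside \<open>dom f\<close>, which is measurable because its
  complement is null.\<close>

lemma young_functionI:
  fixes f :: "'a \<rightharpoonup> ('b::second_countable_topology set \<Rightarrow> ennreal)"
  assumes om: "outer_measure_space UNIV \<mu>" and dom: "\<mu> (- dom f) = 0" and ran: "ran f \<subseteq> prob_radon"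
    and meas: "\<And>V. open V \<Longrightarrow> (\<lambda>x. measure (young_kernel f x) V) \<in> borel_measurable (measure_of_outer \<mu>)"
  shows "young_function \<mu> f"
  unfolding young_function_def
proof (intro conjI allI impI dom ran)
  let ?M = "measure_of_outer \<mu>"
  fix U :: "('b set \<Rightarrow> ennreal) set" assume U: "openin prob_radon_topology U"
  have ranD: "\<nu> \<in> prob_radon" if "f x = Some \<nu>" for x \<nu>
    using ranI[of f x, OF that] ran by blast
  have "- dom f \<in> sets ?M" using caratheodory_null[OF om dom] by (simp add: sets_measure_of_outer[OF om])
  then have domM: "dom f \<in> sets ?M" using sets.compl_sets[of "- dom f" ?M] by (simp add: Compl_eq_Diff_UNIV[symmetric])
  obtain \<B> :: "'b set set" where \<B>: "\<forall>B\<in>\<B>. open B"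
    "\<forall>U. openin prob_radon_topology U \<longrightarrow>
      U \<in> sigma_sets prob_radon {{\<nu> \<in> prob_radon. of_rat r < measure (borel_part \<nu>) B} | r B. B \<in> \<B>}"
    by (rule prob_radon_openin_sigma)
  from \<B>(2)[rule_format, OF U] have "f -` (Some ` U) \<in> sets ?M"
  proof induction
    case (Basic S)
    then obtain r B where S: "S = {\<nu> \<in> prob_radon. of_rat r < measure (borel_part \<nu>) B}" "open B"
      using \<B>(1) by auto
    have "{x \<in> space ?M. of_rat r < measure (young_kernel f x) B} \<in> sets ?M"
      using meas[OF S(2)] by measurable
    moreover have "f -` (Some ` S) = dom f \<inter> {x \<in> space ?M. of_rat r < measure (young_kernel f x) B}"
      using ranD by (auto simp: S young_kernel_def image_iff)
    ultimately show ?case using domM by simp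
  next
    case (Compl S)
    have "f -` (Some ` (prob_radon - S)) = dom f - f -` (Some ` S)"
      using ranD by (auto simp: image_iff)
    then show ?case using Compl.IH domM by simp
  next
    case (Union S)
    have "f -` (Some ` (\<Union>i. S i)) = (\<Union>i. f -` (Some ` S i))" by auto
    then show ?case using Union.IH by auto
  qed simp
  then show "f -` (Some ` U) \<in> caratheodory_sets \<mu>" by (simp add: sets_measure_of_outer[OF om])
qed

section \<open>Graph measures\<close>

text \<open>The mixture over \<open>M\<close> of the measures \<open>\<kappa> x\<close> placed on
  the fibres above \<open>x\<close>. The target is the Borel sigma-algebra even when
  \<open>M\<close> has further measurable sets.\<close>

definition graph_borel ::
  "'a::topological_space measure \<Rightarrow> ('a \<Rightarrow> 'b::topological_space measure) \<Rightarrow> ('a \<times> 'b) measure" where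
  "graph_borel M \<kappa> = M \<bind> (\<lambda>x. distr (\<kappa> x) borel (Pair x))"

lemma borel_Times:
  fixes E :: "'a::second_countable_topology set" and B :: "'b::second_countable_topology set"
  assumes "E \<in> sets borel" "B \<in> sets borel"
  shows "E \<times> B \<in> sets borel"
  unfolding borel_prod[symmetric] using assms by (rule pair_measureI)

section \<open>Integration against a mixture whose base measure covers the Borel sets\<close>

context
  fixes M :: "'a::second_countable_topology measure" and \<kappa> :: "'a \<Rightarrow> 'b::second_countable_topology measure"
  assumes M: "space M = UNIV" "sets borel \<subseteq> sets M"
    and \<kappa>: "\<kappa> \<in> measurable M (subprob_algebra borel)"
begin

lemma subprob_kernel: "subprob_space (\<kappa> x)" "sets (\<kappa> x) = sets borel" "space (\<kappa> x) = UNIV"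
proof -
  have "\<kappa> x \<in> space (subprob_algebra borel)" using \<kappa> M(1) by (intro measurable_space[OF \<kappa>]) simp
  then show "subprob_space (\<kappa> x)" and s: "sets (\<kappa> x) = sets borel" by (auto simp: space_subprob_algebra)
  show "space (\<kappa> x) = UNIV" using sets_eq_imp_space_eq[OF s] by simp
qed

text \<open>Second countability identifies the Borel sets of the product with the product
  sigma-algebra, so measurability may be checked coordinatewise.\<close>

lemma borel_prod_measurable_ident: "(\<lambda>p. p) \<in> measurable (M \<Otimes>\<^sub>M borel) (borel :: ('a \<times> 'b) measure)"
proof -
  have id: "(\<lambda>x. x) \<in> measurable M (borel :: 'a measure)"
    using M by (auto simp: measurable_def)
  have "(\<lambda>p. (fst p, snd p)) \<in> measurable (M \<Otimes>\<^sub>M borel) (borel \<Otimes>\<^sub>M (borel :: 'b measure))"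
    by (intro measurable_Pair measurable_compose[OF measurable_fst id] measurable_snd)
  then show ?thesis by (simp add: borel_prod)
qed

lemma graph_kernel_measurable:
  "(\<lambda>x. distr (\<kappa> x) (borel :: ('a \<times> 'b) measure) (Pair x)) \<in> measurable M (subprob_algebra borel)"
proof (rule measurable_distr2[OF _ \<kappa>])
  have "case_prod Pair = (\<lambda>p :: 'a \<times> 'b. p)" by (simp add: fun_eq_iff)
  then show "case_prod Pair \<in> measurable (M \<Otimes>\<^sub>M borel) (borel :: ('a \<times> 'b) measure)"
    using borel_prod_measurable_ident by simp
qed

lemma sets_graph_borel [simp]: "sets (graph_borel M \<kappa>) = sets borel"
  unfolding graph_borel_def using M by (intro sets_bind) auto

lemma Pair_measurable_kernel: "Pair x \<in> measurable (\<kappa> x') (borel :: ('a \<times> 'b) measure)"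
proof -
  have "Pair x \<in> measurable borel (borel :: ('a \<times> 'b) measure)"
    by (intro borel_measurable_continuous_onI continuous_intros)
  then show ?thesis by (simp add: measurable_cong_sets[OF subprob_kernel(2) refl])
qed

lemma nn_integral_graph_borel:
  assumes "u \<in> borel_measurable borel"
  shows "(\<integral>\<^sup>+p. u p \<partial>graph_borel M \<kappa>) = (\<integral>\<^sup>+x. \<integral>\<^sup>+y. u (x, y) \<partial>\<kappa> x \<partial>M)"
  unfolding graph_borel_def
  by (subst nn_integral_bind[OF assms graph_kernel_measurable])
    (intro nn_integral_cong nn_integral_distr Pair_measurable_kernel, use assms in simp)

lemma emeasure_graph_borel_Times:
  assumes "E \<in> sets borel" "B \<in> sets borel"
  shows "emeasure (graph_borel M \<kappa>) (E \<times> B) = (\<integral>\<^sup>+x. emeasure (\<kappa> x) B * indicator E x \<partial>M)"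
proof -
  have EB: "E \<times> B \<in> sets borel"
    using assms by (rule borel_Times)
  have "emeasure (graph_borel M \<kappa>) (E \<times> B) = (\<integral>\<^sup>+p. indicator (E \<times> B) p \<partial>graph_borel M \<kappa>)"
    using EB by simp
  also have "\<dots> = (\<integral>\<^sup>+x. \<integral>\<^sup>+y. indicator (E \<times> B) (x, y) \<partial>\<kappa> x \<partial>M)"
    using EB by (intro nn_integral_graph_borel) simp
  also have "\<dots> = (\<integral>\<^sup>+x. emeasure (\<kappa> x) B * indicator E x \<partial>M)"
  proof (intro nn_integral_cong)
    fix x
    have "(\<integral>\<^sup>+y. indicator (E \<times> B) (x, y) \<partial>\<kappa> x) = (\<integral>\<^sup>+y. indicator E x * indicator B y \<partial>\<kappa> x)"
      by (intro nn_integral_cong) (auto simp: indicator_def)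
    then show "(\<integral>\<^sup>+y. indicator (E \<times> B) (x, y) \<partial>\<kappa> x) = emeasure (\<kappa> x) B * indicator E x"
      using assms(2) nn_integral_cmult_indicator[of B "\<kappa> x" "indicator E x"]
      by (simp add: subprob_kernel mult.commute[of _ "indicator E x"])
  qed
  finally show ?thesis .
qed

text \<open>The bound \<open>C\<close> makes every inner integral finite, so both sides are real
  versions of the same finite nonnegative integral.\<close>

lemma integral_graph_borel_nonneg:
  fixes \<psi> :: "'a \<times> 'b \<Rightarrow> real"
  assumes \<psi>: "\<psi> \<in> borel_measurable borel" "\<And>p. 0 \<le> \<psi> p" "\<And>p. \<psi> p \<le> C"
    and int: "integrable (graph_borel M \<kappa>) \<psi>"
  shows "integrable M (\<lambda>x. \<integral>y. \<psi> (x, y) \<partial>\<kappa> x)"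
    and "integral\<^sup>L (graph_borel M \<kappa>) \<psi> = (\<integral>x. \<integral>y. \<psi> (x, y) \<partial>\<kappa> x \<partial>M)"
proof -
  have inner: "ennreal (\<integral>y. \<psi> (x, y) \<partial>\<kappa> x) = (\<integral>\<^sup>+y. ennreal (\<psi> (x, y)) \<partial>\<kappa> x)" for x
  proof -
    interpret subprob_space "\<kappa> x" by (rule subprob_kernel)
    have "integrable (\<kappa> x) (\<lambda>y. \<psi> (x, y))"
      using \<psi> measurable_compose[OF Pair_measurable_kernel \<psi>(1)]
      by (intro integrable_const_bound[of _ C]) auto
    then show ?thesis using \<psi>(2) by (simp add: nn_integral_eq_integral)
  qed
  have meas: "(\<lambda>x. \<integral>y. \<psi> (x, y) \<partial>\<kappa> x) \<in> borel_measurable M"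
  proof -
    have "(\<lambda>x. \<integral>\<^sup>+y. ennreal (\<psi> (x, y)) \<partial>\<kappa> x) \<in> borel_measurable M"
      using measurable_compose[OF borel_prod_measurable_ident \<psi>(1)]
      by (intro nn_integral_measurable_subprob_algebra2[OF _ \<kappa>]) (simp add: case_prod_unfold)
    then have "(\<lambda>x. enn2real (\<integral>\<^sup>+y. ennreal (\<psi> (x, y)) \<partial>\<kappa> x)) \<in> borel_measurable M"
      by measurable
    then show ?thesis using \<psi>(2) by (simp add: inner[symmetric])
  qed
  have eq: "(\<integral>\<^sup>+x. ennreal (\<integral>y. \<psi> (x, y) \<partial>\<kappa> x) \<partial>M) = (\<integral>\<^sup>+p. ennreal (\<psi> p) \<partial>graph_borel M \<kappa>)"
    using \<psi>(1) by (simp add: inner nn_integral_graph_borel)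
  also have "\<dots> < \<infinity>"
    using int \<psi>(2) by (simp add: nn_integral_eq_integral)
  finally show "integrable M (\<lambda>x. \<integral>y. \<psi> (x, y) \<partial>\<kappa> x)"
    using meas \<psi>(2) by (intro integrableI_nonneg) auto
  have "integral\<^sup>L (graph_borel M \<kappa>) \<psi> = enn2real (\<integral>\<^sup>+p. ennreal (\<psi> p) \<partial>graph_borel M \<kappa>)"
    using \<psi> by (intro integral_eq_nn_integral) (auto simp: measurable_cong_sets[OF sets_graph_borel refl])
  also have "\<dots> = (\<integral>x. \<integral>y. \<psi> (x, y) \<partial>\<kappa> x \<partial>M)"
    unfolding eq[symmetric] using meas \<psi>(2) by (intro integral_eq_nn_integral[symmetric]) auto
  finally show "integral\<^sup>L (graph_borel M \<kappa>) \<psi> = (\<integral>x. \<integral>y. \<psi> (x, y) \<partial>\<kappa> x \<partial>M)" .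
qed

text \<open>Positive and negative part are both bounded by \<open>C\<close>; their inner integrals
  recombine pointwise because each \<open>\<kappa> x\<close> is finite.\<close>

lemma integral_graph_borel:
  fixes \<psi> :: "'a \<times> 'b \<Rightarrow> real"
  assumes \<psi>: "\<psi> \<in> borel_measurable borel" "\<And>p. \<bar>\<psi> p\<bar> \<le> C"
    and int: "integrable (graph_borel M \<kappa>) \<psi>"
  shows "integral\<^sup>L (graph_borel M \<kappa>) \<psi> = (\<integral>x. \<integral>y. \<psi> (x, y) \<partial>\<kappa> x \<partial>M)"
proof -
  let ?p = "\<lambda>p. max 0 (\<psi> p)" and ?n = "\<lambda>p. max 0 (- \<psi> p)"
  have bd: "?p p \<le> C" "?n p \<le> C" for p using \<psi>(2)[of p] by auto
  have meas: "?p \<in> borel_measurable borel" "?n \<in> borel_measurable borel" using \<psi>(1) by simp_all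
  have ints: "integrable (graph_borel M \<kappa>) ?p" "integrable (graph_borel M \<kappa>) ?n" using int by simp_all
  note P = integral_graph_borel_nonneg[OF meas(1) _ bd(1) ints(1), simplified]
  note N = integral_graph_borel_nonneg[OF meas(2) _ bd(2) ints(2), simplified]
  have "integral\<^sup>L (graph_borel M \<kappa>) \<psi> = integral\<^sup>L (graph_borel M \<kappa>) (\<lambda>p. ?p p - ?n p)"
    by (intro Bochner_Integration.integral_cong) auto
  also have "\<dots> = integral\<^sup>L (graph_borel M \<kappa>) ?p - integral\<^sup>L (graph_borel M \<kappa>) ?n"
    using ints by (rule Bochner_Integration.integral_diff)
  also have "\<dots> = (\<integral>x. (\<integral>y. ?p (x, y) \<partial>\<kappa> x) - (\<integral>y. ?n (x, y) \<partial>\<kappa> x) \<partial>M)"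
    using P N by simp
  also have "\<dots> = (\<integral>x. \<integral>y. \<psi> (x, y) \<partial>\<kappa> x \<partial>M)"
  proof (intro Bochner_Integration.integral_cong refl)
    fix x
    interpret subprob_space "\<kappa> x" by (rule subprob_kernel)
    have "integrable (\<kappa> x) (\<lambda>y. \<psi> (x, y))"
      using \<psi> measurable_compose[OF Pair_measurable_kernel \<psi>(1)]
      by (intro integrable_const_bound[of _ C]) auto
    then have "(\<integral>y. ?p (x, y) \<partial>\<kappa> x) - (\<integral>y. ?n (x, y) \<partial>\<kappa> x) = (\<integral>y. ?p (x, y) - ?n (x, y) \<partial>\<kappa> x)"
      by simp
    also have "\<dots> = (\<integral>y. \<psi> (x, y) \<partial>\<kappa> x)"
      by (intro Bochner_Integration.integral_cong) auto
    finally show "(\<integral>y. ?p (x, y) \<partial>\<kappa> x) - (\<integral>y. ?n (x, y) \<partial>\<kappa> x) = (\<integral>y. \<psi> (x, y) \<partial>\<kappa> x)" .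
  qed
  finally show ?thesis .
qed

end

text \<open>\<open>K\<close> lies in the cylinder over its compact projection, and the kernel has
  mass at most one, so the mass of the projection is an upper bound.\<close>

lemma graph_borel_finite_compact:
  fixes \<mu> :: "'a::{second_countable_topology, t2_space} set \<Rightarrow> ennreal"
    and \<kappa> :: "'a \<Rightarrow> 'b::{second_countable_topology, t2_space} measure"
  assumes \<mu>: "radon_measure \<mu>" and \<kappa>: "\<kappa> \<in> measurable (measure_of_outer \<mu>) (subprob_algebra borel)"
    and K: "compact K"
  shows "emeasure (graph_borel (measure_of_outer \<mu>) \<kappa>) K < \<infinity>"
proof -
  note M = space_measure_of_outer borel_part_subalgebra(1)[OF \<mu>, unfolded sets_borel_part]
  have fK: "compact (fst ` K)" using K by (intro compact_continuous_image continuous_on_fst continuous_on_id)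
  then have bK: "fst ` K \<in> sets borel" by (intro borel_closed compact_imp_closed)
  have "fst ` K \<times> (UNIV :: 'b set) \<in> sets borel"
    using bK by (intro borel_Times) auto
  then have "emeasure (graph_borel (measure_of_outer \<mu>) \<kappa>) K
      \<le> emeasure (graph_borel (measure_of_outer \<mu>) \<kappa>) (fst ` K \<times> UNIV)"
    by (intro emeasure_mono) (force simp: sets_graph_borel[OF M \<kappa>])+
  also have "\<dots> = (\<integral>\<^sup>+x. emeasure (\<kappa> x) UNIV * indicator (fst ` K) x \<partial>measure_of_outer \<mu>)"
    using bK by (intro emeasure_graph_borel_Times[OF M \<kappa>]) auto
  also have "\<dots> \<le> (\<integral>\<^sup>+x. indicator (fst ` K) x \<partial>measure_of_outer \<mu>)"
  proof (intro nn_integral_mono)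
    fix x
    have "emeasure (\<kappa> x) UNIV \<le> 1"
      using subprob_space.emeasure_space_le_1[OF subprob_kernel(1)[OF M \<kappa>, of x]]
      by (simp add: subprob_kernel(3)[OF M \<kappa>])
    then show "emeasure (\<kappa> x) UNIV * indicator (fst ` K) x \<le> indicator (fst ` K) x"
      by (simp add: indicator_def)
  qed
  also have "\<dots> = \<mu> (fst ` K)"
    using bK M(2) borel_part_subalgebra(2)[OF \<mu>, of "fst ` K"] by (auto simp: emeasure_borel_part[OF \<mu>])
  also have "\<dots> < \<infinity>" by (rule radon_finite_compact[OF \<mu> fK])
  finally show ?thesis .
qed

text \<open>Where \<open>f\<close> is undefined, the zero measure contributes the prescribed default
  \<open>0\<close>.\<close>

lemma young_integral_eq:
  assumes f: "ran f \<subseteq> prob_radon" and \<psi>: "\<psi> \<in> borel_measurable borel"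
  shows "young_integral \<mu> f \<psi> = (\<integral>x. \<integral>y. \<psi> (x, y) \<partial>young_kernel f x \<partial>measure_of_outer \<mu>)"
  unfolding young_integral_def outer_integral_def[of \<mu>]
proof (intro Bochner_Integration.integral_cong refl)
  fix x
  have meas: "(\<lambda>y. \<psi> (x, y)) \<in> borel_measurable borel"
    by (intro measurable_compose[OF _ \<psi>] borel_measurable_continuous_onI continuous_intros)
  show "(case f x of None \<Rightarrow> 0 | Some \<nu> \<Rightarrow> outer_integral \<nu> (\<lambda>y. \<psi> (x, y))) = (\<integral>y. \<psi> (x, y) \<partial>young_kernel f x)"
  proof (cases "f x")
    case None
    have "(\<integral>y. \<psi> (x, y) \<partial>null_measure borel) = 0"
      by (intro integral_eq_zero_AE AE_I[of _ _ UNIV]) auto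
    with None show ?thesis by (simp add: young_kernel_def)
  next
    case (Some \<nu>)
    then have "radon_measure \<nu>" using f ranI[of f x \<nu>] prob_radonD(1) by blast
    with Some show ?thesis by (simp add: young_kernel_def outer_integral_borel[OF _ meas])
  qed
qed

text \<open>This resolves the definite description: the Radon extension of the mixture has the
  prescribed integrals, and test functions determine a Radon measure.\<close>

theorem borel_part_graph_measure:
  fixes \<mu> :: "'a::{second_countable_topology, t2_space} set \<Rightarrow> ennreal"
    and f :: "'a \<rightharpoonup> ('b::{second_countable_topology, t2_space} set \<Rightarrow> ennreal)"
  assumes lc: "locally_compact_space (euclidean :: 'a topology)"
      "locally_compact_space (euclidean :: 'b topology)"
    and \<mu>: "radon_measure \<mu>" and f: "young_function \<mu> f"
  shows "radon_measure (graph_measure \<mu> f)"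
    and "borel_part (graph_measure \<mu> f) = graph_borel (measure_of_outer \<mu>) (young_kernel f)"
proof -
  note lcp = locally_compact_space_euclidean_prod[OF lc]
  note M = space_measure_of_outer borel_part_subalgebra(1)[OF \<mu>, unfolded sets_borel_part]
  have \<kappa>: "young_kernel f \<in> measurable (measure_of_outer \<mu>) (subprob_algebra borel)"
    by (rule young_function_kernel_measurable[OF lc(2) radon_outer_measure[OF \<mu>] f])
  let ?G = "graph_borel (measure_of_outer \<mu>) (young_kernel f)"
  have sG: "sets ?G = sets borel" by (rule sets_graph_borel[OF M \<kappa>])
  have fin: "emeasure ?G K < \<infinity>" if "compact K" for K
    by (rule graph_borel_finite_compact[OF \<mu> \<kappa> that])
  have R: "radon_measure (radon_extension ?G)"
    by (rule radon_measure_radon_extension[OF lcp sG fin])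
  have B: "borel_part (radon_extension ?G) = ?G"
    by (rule borel_part_radon_extension[OF lcp sG fin])
  have I: "outer_integral (radon_extension ?G) \<psi> = young_integral \<mu> f \<psi>"
    if \<psi>: "\<psi> \<in> compactly_supported" for \<psi>
  proof -
    note m = compactly_supportedD(2)[OF \<psi>]
    obtain C K where C: "0 \<le> C" "\<And>x. \<bar>\<psi> x\<bar> \<le> C * indicator K x"
      using compactly_supportedD(3)[OF \<psi>] by blast
    have bd: "\<bar>\<psi> x\<bar> \<le> C" for x
      using C(1) by (intro order_trans[OF C(2)]) (simp add: indicator_def)
    have ran: "ran f \<subseteq> prob_radon" using f by (simp add: young_function_def)
    show ?thesis
      unfolding outer_integral_borel[OF R m] B young_integral_eq[OF ran m]
      using fin by (intro integral_graph_borel[OF M \<kappa> m bd] compactly_supported_integrable[OF sG _ \<psi>])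
  qed
  have "graph_measure \<mu> f = radon_extension ?G"
    unfolding graph_measure_def
  proof (rule the_equality)
    show "radon_measure (radon_extension ?G) \<and>
      (\<forall>\<psi>\<in>compactly_supported. outer_integral (radon_extension ?G) \<psi> = young_integral \<mu> f \<psi>)"
      using R I by blast
    fix G assume G: "radon_measure G \<and>
      (\<forall>\<psi>\<in>compactly_supported. outer_integral G \<psi> = young_integral \<mu> f \<psi>)"
    show "G = radon_extension ?G"
      by (rule radon_measure_eqI[OF lcp _ R]) (use G I in auto)
  qed
  with R B show "radon_measure (graph_measure \<mu> f)" "borel_part (graph_measure \<mu> f) = ?G" by simp_all
qed

section \<open>Countable algebras and almost uniqueness\<close>

text \<open>Complements and pairwise unions are adjoined stage by stage. Each stage is countable,
  and since the stages increase, any two sets occur in a common one.\<close>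

lemma countable_generated_algebra:
  fixes S :: "'a set set"
  assumes "countable S"
  obtains \<A> where "countable \<A>" "S \<subseteq> \<A>" "algebra UNIV \<A>" "\<A> \<subseteq> sigma_sets UNIV S"
proof -
  define step where "step T = T \<union> uminus ` T \<union> (\<lambda>(a, b). a \<union> b) ` (T \<times> T)" for T :: "'a set set"
  define A where "A n = (step ^^ n) (insert {} S)" for n
  have A0: "A 0 = insert {} S" and AS: "A (Suc n) = step (A n)" for n by (simp_all add: A_def)
  have inc: "incseq A" by (rule incseq_SucI) (auto simp: AS step_def)
  have cA: "countable (A n)" for n
    by (induction n) (use assms in \<open>auto simp: A0 AS step_def\<close>)
  have sub: "A n \<subseteq> sigma_sets UNIV S" for n
  proof (induction n)
    case 0
    show ?case by (auto simp: A0 intro: sigma_sets.Empty sigma_sets.Basic)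
  next
    case (Suc n)
    interpret sigma_algebra UNIV "sigma_sets UNIV S" by (rule sigma_algebra_sigma_sets) simp
    have "- a \<in> sigma_sets UNIV S" if "a \<in> A n" for a
      using Suc that compl_sets[of a] by (auto simp: Compl_eq_Diff_UNIV)
    moreover have "a \<union> b \<in> sigma_sets UNIV S" if "a \<in> A n" "b \<in> A n" for a b
      using Suc that by (intro Un) auto
    ultimately show ?case using Suc by (auto simp: AS step_def)
  qed
  have "algebra UNIV (\<Union>n. A n)"
    unfolding algebra_iff_Un
  proof (intro conjI ballI)
    show "{} \<in> (\<Union>n. A n)" using A0 by (intro UN_I[of 0]) auto
    fix a assume "a \<in> (\<Union>n. A n)"
    then obtain n where n: "a \<in> A n" by blast
    then have "- a \<in> A (Suc n)" by (auto simp: AS step_def)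
    then show "UNIV - a \<in> (\<Union>n. A n)" unfolding Compl_eq_Diff_UNIV by blast
    fix b assume "b \<in> (\<Union>n. A n)"
    then obtain m where m: "b \<in> A m" by blast
    have "a \<in> A (max n m)" "b \<in> A (max n m)"
      using n m incseqD[OF inc, of n "max n m"] incseqD[OF inc, of m "max n m"] by auto
    then have "a \<union> b \<in> A (Suc (max n m))" by (force simp: AS step_def)
    then show "a \<union> b \<in> (\<Union>n. A n)" by blast
  qed simp
  moreover have "S \<subseteq> (\<Union>n. A n)" using A0 by blast
  moreover have "countable (\<Union>n. A n)" using cA by auto
  moreover have "(\<Union>n. A n) \<subseteq> sigma_sets UNIV S" using sub by blast
  ultimately show ?thesis by (intro that)
qed

text \<open>The base is returned along with the algebra because products of base sets will generate
  the Borel sets of \<open>X \<times> Y\<close>.\<close>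

lemma countable_borel_algebra:
  obtains \<A> \<B> :: "'a::second_countable_topology set set" where "countable \<A>" "algebra UNIV \<A>"
    "sets borel = sigma_sets UNIV \<A>" "countable \<B>" "topological_basis \<B>" "\<B> \<subseteq> \<A>"
proof -
  obtain \<B> :: "'a set set" where B: "countable \<B>" "topological_basis \<B>"
    using ex_countable_basis by blast
  obtain \<A> where A: "countable \<A>" "\<B> \<subseteq> \<A>" "algebra UNIV \<A>" "\<A> \<subseteq> sigma_sets UNIV \<B>"
    using countable_generated_algebra[OF B(1)] by metis
  have b: "sets borel = sigma_sets UNIV \<B>"
    unfolding borel_eq_countable_basis[OF B] by (rule sets_measure_of) simp
  have "sigma_sets UNIV \<A> = sigma_sets UNIV \<B>"
    using A(2,4) by (intro sigma_sets_eqI) (auto intro: sigma_sets.Basic)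
  with A B b show ?thesis by (intro that[of \<A> \<B>]) simp_all
qed

lemma algebra_Int_stable: "algebra \<Omega> \<A> \<Longrightarrow> Int_stable \<A>"
  by (auto simp: algebra_iff_Int Int_stable_def)

section \<open>Compactness as a source of countable additivity\<close>

lemma compact_Inter_finite_empty:
  fixes K :: "nat \<Rightarrow> 'a::t2_space set"
  assumes "\<And>i. compact (K i)" "(\<Inter>i. K i) = {}"
  obtains n where "(\<Inter>i\<le>n. K i) = {}"
proof (rule ccontr)
  assume "\<not> thesis"
  with that have ne: "(\<Inter>i\<le>n. K i) \<noteq> {}" for n by blast
  have "K 0 \<inter> (\<Inter>i\<in>UNIV. K i) \<noteq> {}"
  proof (rule compact_imp_fip_image[OF assms(1)])
    show "closed (K i)" for i using assms(1) by (rule compact_imp_closed)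
    fix I :: "nat set" assume I: "finite I"
    \<comment> \<open>\<open>Max\<close> requires a nonempty set; inserting \<open>0\<close> covers
      \<open>I = {}\<close>.\<close>
    have "I \<subseteq> {..Max (insert 0 I)}" using I by auto
    then have "(\<Inter>i\<le>Max (insert 0 I). K i) \<subseteq> K 0 \<inter> (\<Inter>i\<in>I. K i)" by auto
    then have sub: "K 0 \<inter> (\<Inter>i\<in>I. K i) = {} \<Longrightarrow> (\<Inter>i\<le>Max (insert 0 I). K i) = {}" by simp
    show "K 0 \<inter> (\<Inter>i\<in>I. K i) \<noteq> {}"
      using ne[of "Max (insert 0 I)"] by (rule contrapos_nn) (rule sub)
  qed
  with assms(2) show False by blast
qed

text \<open>Inner approximation by compact sets makes a finitely additive set function countably additive;
  the approximating sets need only lie in a larger algebra.\<close>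

lemma compact_approximable_content_extension:
  fixes \<A>0 \<A>1 :: "'a::t2_space set set"
  assumes A0: "algebra UNIV \<A>0" and A1: "algebra UNIV \<A>1" and sub: "\<A>0 \<subseteq> \<A>1"
    and c: "positive \<A>1 c" "additive \<A>1 c" "c UNIV < \<infinity>"
    and K: "\<And>A n. A \<in> \<A>0 \<Longrightarrow> K A n \<in> \<A>1 \<and> compact (K A n) \<and> K A n \<subseteq> A"
    and cK: "\<And>A. A \<in> \<A>0 \<Longrightarrow> c A = (SUP n :: nat. c (K A n))"
  shows "\<exists>N. sets N = sigma_sets UNIV \<A>0 \<and> (\<forall>A\<in>\<A>0. emeasure N A = c A)"
proof -
  interpret A0: algebra UNIV \<A>0 by fact
  interpret A1: algebra UNIV \<A>1 by fact
  have mono: "c A \<le> c B" if "A \<in> \<A>1" "B \<in> \<A>1" "A \<subseteq> B" for A B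
    using A1.additive_increasing[OF c(1,2)] that by (auto simp: increasing_def)
  have fin: "c A < \<infinity>" if "A \<in> \<A>1" for A
    using mono[OF that A1.top] c(3) by simp
  have add: "c (A \<union> B) = c A + c B" if "A \<in> \<A>1" "B \<in> \<A>1" "A \<inter> B = {}" for A B
    using c(2) that by (auto simp: additive_def)
  have subadd: "c (A \<union> B) \<le> c A + c B" if "A \<in> \<A>1" "B \<in> \<A>1" for A B
  proof -
    have "c (A \<union> (B - A)) = c A + c (B - A)" using that by (intro add) auto
    also have "\<dots> \<le> c A + c B" using that by (intro add_left_mono mono) auto
    finally show ?thesis by simp
  qed
  have subsum: "c (\<Union>i\<le>n. D i) \<le> (\<Sum>i\<le>n. c (D i))" if "\<And>i. D i \<in> \<A>1" for D :: "nat \<Rightarrow> 'a set" and n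
  proof (induction n)
    case (Suc n)
    have "c (\<Union>i\<le>Suc n. D i) = c ((\<Union>i\<le>n. D i) \<union> D (Suc n))" by (simp add: atMost_Suc Un_commute)
    also have "\<dots> \<le> c (\<Union>i\<le>n. D i) + c (D (Suc n))" using that by (intro subadd) auto
    also have "\<dots> \<le> (\<Sum>i\<le>n. c (D i)) + c (D (Suc n))" by (intro add_right_mono Suc)
    finally show ?case by simp
  qed simp
  \<comment> \<open>The hypothesis bounds masses, not differences; finiteness of \<open>c A\<close>
    allows the cancellation that converts one into the other.\<close>
  have approx: "\<exists>n. c (A - K A n) \<le> ennreal e" if A: "A \<in> \<A>0" and e: "0 < e" for A e
  proof (rule ccontr)
    assume "\<nexists>n. c (A - K A n) \<le> ennreal e"
    then have gt: "ennreal e \<le> c (A - K A n)" for n by (auto simp: not_le less_imp_le)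
    have "c (K A n) + ennreal e \<le> c A" for n
    proof -
      have "c (K A n) + ennreal e \<le> c (K A n) + c (A - K A n)" by (intro add_left_mono gt)
      also have "\<dots> = c (K A n \<union> (A - K A n))" using K[OF A, of n] A sub by (intro add[symmetric]) auto
      also have "K A n \<union> (A - K A n) = A" using K[OF A, of n] by auto
      finally show ?thesis .
    qed
    then have "(SUP n. c (K A n) + ennreal e) \<le> c A" by (intro SUP_least)
    then have "(SUP n. c (K A n)) + ennreal e \<le> c A" by (simp add: ennreal_SUP_add_left)
    then have "c A + ennreal e \<le> c A + 0" by (simp add: cK[OF A, symmetric])
    moreover have "c A \<noteq> top" using fin[of A] A sub by auto
    ultimately have "ennreal e \<le> 0" by (subst (asm) ennreal_add_left_cancel_le) auto
    with e show False by simp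
  qed
  \<comment> \<open>Continuity at the empty set is tested on sequences from \<open>\<A>0\<close>
    only; the compact sets and differences that prove it are measured in
    \<open>\<A>1\<close>.\<close>
  have "\<exists>\<mu>. (\<forall>s\<in>\<A>0. \<mu> s = c s) \<and> measure_space UNIV (sigma_sets UNIV \<A>0) \<mu>"
  proof (rule A0.caratheodory_empty_continuous)
    show "positive \<A>0 c" using c(1) by (simp add: positive_def)
    show "additive \<A>0 c" using c(2) sub by (auto simp: additive_def)
    show "c A \<noteq> \<infinity>" if "A \<in> \<A>0" for A using fin[of A] that sub by auto
    fix A :: "nat \<Rightarrow> 'a set" assume A: "range A \<subseteq> \<A>0" "decseq A" "(\<Inter>i. A i) = {}"
    then have Ai: "A i \<in> \<A>0" "A i \<in> \<A>1" for i using sub by auto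
    have dec: "decseq (\<lambda>i. c (A i))" using Ai decseqD[OF A(2)] by (intro antimonoI mono) auto
    have "(INF i. c (A i)) \<le> 0"
    proof (rule ennreal_le_epsilon)
      fix e :: real assume e: "0 < e"
      \<comment> \<open>Compact \<open>L i\<close> are placed inside \<open>A i\<close> with total
        loss at most \<open>e\<close>. Their intersection is empty, hence so is a finite one, and
        then \<open>A n\<close> is covered by the losses \<open>A i - L i\<close> with
        \<open>i \<le> n\<close>.\<close>
      have "\<exists>n. c (A i - K (A i) n) \<le> ennreal (e * (1/2) ^ Suc i)" for i
        using e by (intro approx Ai) simp
      then obtain m where m: "\<And>i. c (A i - K (A i) (m i)) \<le> ennreal (e * (1/2) ^ Suc i)" by metis
      define L where "L i = K (A i) (m i)" for i
      have L: "compact (L i)" "L i \<subseteq> A i" "L i \<in> \<A>1" for i using K[OF Ai(1)] by (auto simp: L_def)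
      have "(\<Inter>i. L i) \<subseteq> (\<Inter>i. A i)" using L(2) by (intro INF_mono) auto
      then have "(\<Inter>i. L i) = {}" using A(3) by simp
      then obtain n where n: "(\<Inter>i\<le>n. L i) = {}" using compact_Inter_finite_empty[of L] L(1) by metis
      have sub': "A n \<subseteq> (\<Union>i\<le>n. A i - L i)"
      proof
        fix x assume x: "x \<in> A n"
        have "x \<notin> (\<Inter>i\<le>n. L i)" using n by simp
        then obtain i where "i \<le> n" "x \<notin> L i" by auto
        moreover from this x have "x \<in> A i" using decseqD[OF A(2)] by blast
        ultimately show "x \<in> (\<Union>i\<le>n. A i - L i)" by auto
      qed
      have "(INF i. c (A i)) \<le> c (A n)" by (rule INF_lower) simp
      also have "\<dots> \<le> c (\<Union>i\<le>n. A i - L i)" using sub' Ai L by (intro mono A1.finite_UN) auto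
      also have "\<dots> \<le> (\<Sum>i\<le>n. c (A i - L i))" using Ai L by (intro subsum) auto
      also have "\<dots> \<le> (\<Sum>i\<le>n. ennreal (e * (1/2) ^ Suc i))"
        using m by (intro sum_mono) (simp add: L_def)
      also have "\<dots> \<le> (\<Sum>i. ennreal (e * (1/2) ^ Suc i))" by (intro sum_le_suminf) auto
      also have "\<dots> = ennreal e" using e by (intro suminf_half_ennreal) simp
      finally show "(INF i. c (A i)) \<le> 0 + ennreal e" by simp
    qed
    then have "(INF i. c (A i)) = 0" by simp
    then show "(\<lambda>i. c (A i)) \<longlonglongrightarrow> 0" using LIMSEQ_INF[OF dec] by simp
  qed
  then obtain \<mu> where \<mu>: "\<And>s. s \<in> \<A>0 \<Longrightarrow> \<mu> s = c s" "measure_space UNIV (sigma_sets UNIV \<A>0) \<mu>" by blast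
  show ?thesis
  proof (intro exI[of _ "measure_of UNIV (sigma_sets UNIV \<A>0) \<mu>"] conjI ballI)
    show "sets (measure_of UNIV (sigma_sets UNIV \<A>0) \<mu>) = sigma_sets UNIV \<A>0"
      by (intro sigma_algebra.sets_measure_of_eq sigma_algebra_sigma_sets) simp
    show "emeasure (measure_of UNIV (sigma_sets UNIV \<A>0) \<mu>) A = c A" if "A \<in> \<A>0" for A
      using \<mu> that
      by (subst emeasure_measure_of_sigma) (auto simp: measure_space_def intro: sigma_sets.Basic)
  qed
qed

section \<open>Almost uniqueness of the Young function\<close>

lemma young_kernel_eq_imp_eq:
  assumes "f x = Some \<nu>" "g x = Some \<nu>'" "\<nu> \<in> prob_radon" "\<nu>' \<in> prob_radon"
    and "young_kernel f x = young_kernel g x"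
  shows "f x = g x"
proof -
  have "borel_part \<nu> = borel_part \<nu>'" using assms(1,2,5) by (simp add: young_kernel_def)
  then have "\<nu> = \<nu>'"
    by (metis assms(3,4) prob_radonD(1) radon_extension_borel_part)
  then show ?thesis unfolding assms(1,2) by simp
qed

theorem young_function_AE_unique:
  fixes \<mu> :: "'a::{second_countable_topology, t2_space} set \<Rightarrow> ennreal"
    and f g :: "'a \<rightharpoonup> ('b::{second_countable_topology, t2_space} set \<Rightarrow> ennreal)"
  assumes lc: "locally_compact_space (euclidean :: 'a topology)"
      "locally_compact_space (euclidean :: 'b topology)"
    and \<mu>: "radon_measure \<mu>" and f: "young_function \<mu> f" and g: "young_function \<mu> g"
    and eq: "graph_measure \<mu> f = graph_measure \<mu> g"
  shows "\<mu> {x. f x \<noteq> g x} = 0"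
proof -
  let ?M = "measure_of_outer \<mu>"
  note om = radon_outer_measure[OF \<mu>]
  note M = space_measure_of_outer borel_part_subalgebra(1)[OF \<mu>, unfolded sets_borel_part]
  have \<kappa>f: "young_kernel f \<in> measurable ?M (subprob_algebra borel)"
    and \<kappa>g: "young_kernel g \<in> measurable ?M (subprob_algebra borel)"
    by (auto intro: young_function_kernel_measurable lc om f g)
  have G: "graph_borel ?M (young_kernel f) = graph_borel ?M (young_kernel g)"
    using borel_part_graph_measure(2)[OF lc \<mu> f] borel_part_graph_measure(2)[OF lc \<mu> g] eq by simp
  obtain \<A> \<B> :: "'b set set" where A: "countable \<A>" "algebra UNIV \<A>" "sets borel = sigma_sets UNIV \<A>"
    by (rule countable_borel_algebra)
  interpret A: algebra UNIV \<A> by fact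
  have "AE x in ?M. emeasure (young_kernel f x) B = emeasure (young_kernel g x) B" if "B \<in> \<A>" for B
  proof (rule AE_eq_by_borel_integrals[OF lc(1) \<mu>])
    have B: "B \<in> sets borel" using that A(3) by auto
    show "(\<lambda>x. emeasure (young_kernel f x) B) \<in> borel_measurable ?M"
      "(\<lambda>x. emeasure (young_kernel g x) B) \<in> borel_measurable ?M"
      using measurable_compose[OF \<kappa>f measurable_emeasure_subprob_algebra[OF B]]
        measurable_compose[OF \<kappa>g measurable_emeasure_subprob_algebra[OF B]] by auto
    fix E :: "'a set" assume E: "E \<in> sets borel"
    show "(\<integral>\<^sup>+x. emeasure (young_kernel f x) B * indicator E x \<partial>?M)
        = (\<integral>\<^sup>+x. emeasure (young_kernel g x) B * indicator E x \<partial>?M)"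
      using emeasure_graph_borel_Times[OF M \<kappa>f E B] emeasure_graph_borel_Times[OF M \<kappa>g E B] G by simp
  qed
  then have "AE x in ?M. \<forall>B\<in>\<A>. emeasure (young_kernel f x) B = emeasure (young_kernel g x) B"
    using A(1) by (intro AE_ball_countable')
  \<comment> \<open>Where both functions are defined, equal kernels mean equal Borel restrictions
    and hence equal Radon measures.\<close>
  moreover have "AE x in ?M. x \<in> dom f" "AE x in ?M. x \<in> dom g"
    using f g by (simp_all add: AE_measure_of_outer_iff[OF om] young_function_def Compl_eq[symmetric])
  ultimately have "AE x in ?M. f x = g x"
  proof eventually_elim
    case (elim x)
    interpret subprob_space "young_kernel f x"
      using f by (intro subprob_space_young_kernel) (simp add: young_function_def)
    \<comment> \<open>Finite total mass lets the constant sequence \<open>UNIV\<close> serve as the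
      exhaustion when measures are compared on \<open>\<A>\<close>.\<close>
    have fin: "emeasure (young_kernel f x) UNIV \<noteq> \<infinity>" by simp
    have k: "young_kernel f x = young_kernel g x"
      by (rule measure_eqI_generator_eq[where E = \<A> and \<Omega> = UNIV and A = "\<lambda>_. UNIV"])
        (use A elim(1) fin in \<open>auto simp: algebra_Int_stable\<close>)
    obtain \<nu> \<nu>' where \<nu>: "f x = Some \<nu>" "g x = Some \<nu>'" using elim(2,3) by auto
    have "\<nu> \<in> prob_radon" "\<nu>' \<in> prob_radon"
      using f g subsetD[OF _ ranI[of f, OF \<nu>(1)]] subsetD[OF _ ranI[of g, OF \<nu>(2)]]
      unfolding young_function_def by blast+
    then show ?case by (rule young_kernel_eq_imp_eq[where f = f and g = g, OF \<nu> _ _ k])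
  qed
  then show ?thesis by (simp add: AE_measure_of_outer_iff[OF om])
qed

section \<open>Disintegration\<close>

text \<open>Disintegration yields a kernel measurable over the Borel restriction \<open>P\<close>,
  while graph measures of Young functions are formed over the Caratheodory sets. A \<open>P\<close>
  measurable integrand has the same integral over both.\<close>

lemma graph_borel_subalgebra:
  fixes \<kappa> :: "'a::second_countable_topology \<Rightarrow> 'b::second_countable_topology measure"
  assumes P: "space P = UNIV" "sets P = sets borel" and M: "space M = UNIV" "sets borel \<subseteq> sets M"
    and em: "\<And>A. A \<in> sets P \<Longrightarrow> emeasure P A = emeasure M A"
    and \<kappa>: "\<kappa> \<in> measurable P (subprob_algebra borel)"
  shows "\<kappa> \<in> measurable M (subprob_algebra borel)" "graph_borel M \<kappa> = graph_borel P \<kappa>"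
proof -
  have P': "sets borel \<subseteq> sets P" using P by simp
  show \<kappa>M: "\<kappa> \<in> measurable M (subprob_algebra borel)"
    using \<kappa> P M by (auto simp: measurable_def)
  show "graph_borel M \<kappa> = graph_borel P \<kappa>"
  proof (rule measure_eqI)
    show "sets (graph_borel M \<kappa>) = sets (graph_borel P \<kappa>)"
      by (simp add: sets_graph_borel[OF M \<kappa>M] sets_graph_borel[OF P(1) P' \<kappa>])
    fix S assume "S \<in> sets (graph_borel M \<kappa>)"
    then have S: "S \<in> sets borel" by (simp add: sets_graph_borel[OF M \<kappa>M])
    have ind: "(\<lambda>p. indicator S p :: ennreal) \<in> borel_measurable borel" using S by simp
    have "(\<lambda>x. \<integral>\<^sup>+y. indicator S (x, y) \<partial>\<kappa> x) \<in> borel_measurable P"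
      using measurable_compose[OF borel_prod_measurable_ident[OF P(1) P' \<kappa>] ind]
      by (intro nn_integral_measurable_subprob_algebra2[OF _ \<kappa>]) (simp add: case_prod_unfold)
    then have "(\<integral>\<^sup>+x. \<integral>\<^sup>+y. indicator S (x, y) \<partial>\<kappa> x \<partial>P) = (\<integral>\<^sup>+x. \<integral>\<^sup>+y. indicator S (x, y) \<partial>\<kappa> x \<partial>M)"
      using P M em by (intro nn_integral_subalgebra) auto
    then have "(\<integral>\<^sup>+p. indicator S p \<partial>graph_borel M \<kappa>) = (\<integral>\<^sup>+p. indicator S p \<partial>graph_borel P \<kappa>)"
      by (simp add: nn_integral_graph_borel[OF M \<kappa>M ind] nn_integral_graph_borel[OF P(1) P' \<kappa> ind])
    then show "emeasure (graph_borel M \<kappa>) S = emeasure (graph_borel P \<kappa>) S"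
      using S by (simp add: sets_graph_borel[OF M \<kappa>M] sets_graph_borel[OF P(1) P' \<kappa>])
  qed
qed

section \<open>Densities with respect to the marginal of a measure on a product\<close>

context
  fixes G :: "('a::{second_countable_topology, t2_space} \<times> 'b::{second_countable_topology, t2_space}) measure"
    and P :: "'a measure"
  assumes sG: "sets G = sets borel" and sP: "sets P = sets borel"
    and PG: "\<And>E. E \<in> sets borel \<Longrightarrow> emeasure P E = emeasure G (E \<times> UNIV)"
    and sf: "sigma_finite_measure P"
begin

lemma marginal_space: "space P = UNIV" "space G = UNIV"
  using sets_eq_imp_space_eq[OF sP] sets_eq_imp_space_eq[OF sG] by auto

lemma projections_measurable: "fst \<in> measurable G (borel :: 'a measure)" "snd \<in> measurable G (borel :: 'b measure)"
  by (auto simp: measurable_cong_sets[OF sG refl] intro!: borel_measurable_continuous_onI continuous_intros)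

text \<open>Since \<open>G (E \<times> B) \<le> G (E \<times> UNIV) = P E\<close>, the left side is,
  as a measure in \<open>E\<close>, absolutely continuous with respect to the marginal.\<close>

lemma marginal_density_exists:
  assumes B: "B \<in> sets borel"
  shows "\<exists>h. h \<in> borel_measurable P \<and>
    (\<forall>E\<in>sets borel. (\<integral>\<^sup>+x. h x * indicator E x \<partial>P) = emeasure G (E \<times> B))"
proof -
  define N where "N = distr (density G (indicator (UNIV \<times> B))) borel fst"
  have UB: "UNIV \<times> B \<in> sets G" using B sG by (simp add: borel_Times)
  have fst: "fst \<in> measurable (density G (indicator (UNIV \<times> B))) (borel :: 'a measure)"
    using projections_measurable(1) by (simp add: measurable_cong_sets[OF sets_density refl])
  have N: "emeasure N E = emeasure G (E \<times> B)" if E: "E \<in> sets borel" for E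
  proof -
    have "emeasure N E = emeasure (density G (indicator (UNIV \<times> B))) (fst -` E \<inter> space G)"
      unfolding N_def using emeasure_distr[OF fst E] by simp
    also have "\<dots> = emeasure G ((UNIV \<times> B) \<inter> (fst -` E \<inter> space G))"
      using UB measurable_sets[OF projections_measurable(1) E] by (rule emeasure_restricted)
    also have "(UNIV \<times> B) \<inter> (fst -` E \<inter> space G) = E \<times> B" by (auto simp: marginal_space)
    finally show ?thesis .
  qed
  have "absolutely_continuous P N"
    unfolding absolutely_continuous_def
  proof
    fix E assume "E \<in> null_sets P"
    then have E: "E \<in> sets borel" "emeasure G (E \<times> UNIV) = 0" using PG[of E] by (auto simp: null_sets_def sP)
    have "emeasure G (E \<times> B) \<le> emeasure G (E \<times> UNIV)"
      using E sG by (intro emeasure_mono) (auto simp: borel_Times)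
    with E show "E \<in> null_sets N" by (auto simp: null_sets_def N) (simp add: N_def)
  qed
  moreover have "sets N = sets P" by (simp add: N_def sP)
  ultimately obtain h where h: "h \<in> borel_measurable P" "density P h = N"
    using sigma_finite_measure.Radon_Nikodym[OF sf] by blast
  have "(\<integral>\<^sup>+x. h x * indicator E x \<partial>P) = emeasure G (E \<times> B)" if E: "E \<in> sets borel" for E
    using emeasure_density[OF h(1), of E] E sP h(2) N by simp
  with h(1) show ?thesis by blast
qed

lemma marginal_AE_eqI:
  assumes "F \<in> borel_measurable P" "F' \<in> borel_measurable P"
    and "\<And>E. E \<in> sets borel \<Longrightarrow> (\<integral>\<^sup>+x. F x * indicator E x \<partial>P) = (\<integral>\<^sup>+x. F' x * indicator E x \<partial>P)"
  shows "AE x in P. F x = F' x"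
  using assms sP
  by (intro sigma_finite_measure.density_unique[OF sf] measure_eqI) (auto simp: emeasure_density)

section \<open>Identities between the densities, each valid almost everywhere\<close>

context
  fixes h :: "'b set \<Rightarrow> 'a \<Rightarrow> ennreal"
  assumes hm: "\<And>B. B \<in> sets borel \<Longrightarrow> h B \<in> borel_measurable P"
    and h: "\<And>B E. B \<in> sets borel \<Longrightarrow> E \<in> sets borel \<Longrightarrow>
      (\<integral>\<^sup>+x. h B x * indicator E x \<partial>P) = emeasure G (E \<times> B)"
begin

lemma conditional_UNIV: "AE x in P. h UNIV x = 1"
  using hm by (intro marginal_AE_eqI) (auto simp: h PG sP)

lemma conditional_empty: "AE x in P. h {} x = 0"
  using hm by (intro marginal_AE_eqI) (auto simp: h)

lemma conditional_Un:
  assumes B: "B \<in> sets borel" "B' \<in> sets borel" "B \<inter> B' = {}"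
  shows "AE x in P. h (B \<union> B') x = h B x + h B' x"
proof (rule marginal_AE_eqI)
  show "h (B \<union> B') \<in> borel_measurable P" "(\<lambda>x. h B x + h B' x) \<in> borel_measurable P"
    using B hm[of B] hm[of B'] hm[of "B \<union> B'"] by auto
  fix E :: "'a set" assume E: "E \<in> sets borel"
  have "(\<integral>\<^sup>+x. (h B x + h B' x) * indicator E x \<partial>P) = (\<integral>\<^sup>+x. h B x * indicator E x + h B' x * indicator E x \<partial>P)"
    by (simp add: distrib_right)
  also have "\<dots> = emeasure G (E \<times> B) + emeasure G (E \<times> B')"
    using B E hm[of B] hm[of B'] sP by (subst nn_integral_add) (auto simp: h)
  also have "\<dots> = emeasure G (E \<times> B \<union> E \<times> B')"
    using B E sG by (intro plus_emeasure) (auto simp: borel_Times)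
  also have "E \<times> B \<union> E \<times> B' = E \<times> (B \<union> B')" by auto
  finally show "(\<integral>\<^sup>+x. h (B \<union> B') x * indicator E x \<partial>P) = (\<integral>\<^sup>+x. (h B x + h B' x) * indicator E x \<partial>P)"
    using B E by (simp add: h)
qed

text \<open>Monotone convergence, for densities that increase only almost everywhere. The part of
  \<open>A\<close> missed by the \<open>K n\<close> is null above all of \<open>X\<close>, so
  \<open>E \<times> A\<close> and \<open>E \<times> (\<Union>n. K n)\<close> have equal
  mass.\<close>

lemma conditional_SUP:
  assumes K: "incseq K" "\<And>n. K n \<in> sets borel" "\<And>n. K n \<subseteq> A" and A: "A \<in> sets borel"
    and null: "emeasure G (UNIV \<times> (A - (\<Union>n. K n))) = 0"
  shows "AE x in P. h A x = (SUP n :: nat. h (K n) x)"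
proof (rule marginal_AE_eqI)
  show "h A \<in> borel_measurable P" "(\<lambda>x. SUP n. h (K n) x) \<in> borel_measurable P"
    using hm A K(2) by auto
  have inc: "AE x in P. h (K n) x \<le> h (K (Suc n)) x" for n
  proof -
    have "K (Suc n) = K n \<union> (K (Suc n) - K n)" using incseq_SucD[OF K(1), of n] by auto
    then have "AE x in P. h (K (Suc n)) x = h (K n) x + h (K (Suc n) - K n) x"
      using conditional_Un[of "K n" "K (Suc n) - K n"] K(2) by auto
    then show ?thesis by eventually_elim simp
  qed
  fix E :: "'a set" assume E: "E \<in> sets borel"
  have "(\<integral>\<^sup>+x. (SUP n. h (K n) x) * indicator E x \<partial>P) = (\<integral>\<^sup>+x. (SUP n. h (K n) x * indicator E x) \<partial>P)"
    by (simp add: SUP_mult_right_ennreal)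
  also have "\<dots> = (SUP n. \<integral>\<^sup>+x. h (K n) x * indicator E x \<partial>P)"
  proof (rule nn_integral_monotone_convergence_SUP_AE)
    show "AE x in P. h (K n) x * indicator E x \<le> h (K (Suc n)) x * indicator E x" for n
      using inc[of n] by eventually_elim (intro mult_right_mono; simp)
    show "(\<lambda>x. h (K n) x * indicator E x) \<in> borel_measurable P" for n
      using hm[OF K(2)] E sP by auto
  qed
  also have "\<dots> = (SUP n. emeasure G (E \<times> K n))" using E K(2) by (simp add: h)
  also have "\<dots> = emeasure G (\<Union>n. E \<times> K n)"
    using E K(1,2) sG by (intro SUP_emeasure_incseq) (auto simp: borel_Times incseq_def)
  also have "(\<Union>n. E \<times> K n) = E \<times> (\<Union>n. K n)" by auto
  also have "emeasure G (E \<times> (\<Union>n. K n)) = emeasure G (E \<times> A)"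
  proof (rule antisym)
    have bK: "(\<Union>n. K n) \<in> sets borel" using K(2) by auto
    show "emeasure G (E \<times> (\<Union>n. K n)) \<le> emeasure G (E \<times> A)"
      using K(3) E A sG by (intro emeasure_mono) (auto simp: borel_Times)
    have "emeasure G (E \<times> A) \<le> emeasure G (E \<times> (\<Union>n. K n) \<union> UNIV \<times> (A - (\<Union>n. K n)))"
    proof (rule emeasure_mono)
      show "E \<times> A \<subseteq> E \<times> (\<Union>n. K n) \<union> UNIV \<times> (A - (\<Union>n. K n))" by blast
      show "E \<times> (\<Union>n. K n) \<union> UNIV \<times> (A - (\<Union>n. K n)) \<in> sets G"
        unfolding sG using bK E A by (intro sets.Un borel_Times sets.Diff) auto
    qed
    also have "\<dots> \<le> emeasure G (E \<times> (\<Union>n. K n)) + emeasure G (UNIV \<times> (A - (\<Union>n. K n)))"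
      unfolding sG using bK E A by (intro emeasure_subadditive) (simp_all add: sG borel_Times sets.Diff)
    finally show "emeasure G (E \<times> A) \<le> emeasure G (E \<times> (\<Union>n. K n))" using null by simp
  qed
  finally show "(\<integral>\<^sup>+x. h A x * indicator E x \<partial>P) = (\<integral>\<^sup>+x. (SUP n. h (K n) x) * indicator E x \<partial>P)"
    using E A by (simp add: h)
qed

end

text \<open>The projection of \<open>G\<close> to \<open>Y\<close> may be infinite on every nonempty
  open set. Cut down to the part above a compact \<open>C j\<close> it is finite, and one sequence
  of compact sets approximates \<open>A\<close> for all these measures.\<close>

lemma fiber_inner_regular:
  assumes lc: "locally_compact_space (euclidean :: 'a topology)"
      "locally_compact_space (euclidean :: 'b topology)"
    and fin: "\<And>K. compact K \<Longrightarrow> emeasure P K < \<infinity>" and A: "A \<in> sets borel"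
  obtains K :: "nat \<Rightarrow> 'b set" where "incseq K" "\<And>n. compact (K n)" "\<And>n. K n \<subseteq> A"
    "emeasure G (UNIV \<times> (A - (\<Union>n. K n))) = 0"
proof -
  obtain C :: "nat \<Rightarrow> 'a set" where C: "\<And>n. compact (C n)" "UNIV = (\<Union>n. C n)"
    using open_Union_compact[OF lc(1) open_UNIV] by metis
  have bC: "C n \<in> sets borel" for n using C(1) by (intro borel_closed compact_imp_closed)
  have CU: "C n \<times> UNIV \<in> sets G" for n using bC sG by (simp add: borel_Times)
  define N where "N j = distr (density G (indicator (C j \<times> UNIV))) borel snd" for j
  have snd: "snd \<in> measurable (density G (indicator (C j \<times> UNIV))) (borel :: 'b measure)" for j
    using projections_measurable(2) by (simp add: measurable_cong_sets[OF sets_density refl])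
  have N: "emeasure (N j) B = emeasure G (C j \<times> B)" if B: "B \<in> sets borel" for j B
  proof -
    have "emeasure (N j) B = emeasure (density G (indicator (C j \<times> UNIV))) (snd -` B \<inter> space G)"
      unfolding N_def using emeasure_distr[OF snd B] by simp
    also have "\<dots> = emeasure G ((C j \<times> UNIV) \<inter> (snd -` B \<inter> space G))"
      using CU measurable_sets[OF projections_measurable(2) B] by (rule emeasure_restricted)
    also have "(C j \<times> UNIV) \<inter> (snd -` B \<inter> space G) = C j \<times> B" by (auto simp: marginal_space)
    finally show ?thesis .
  qed
  have "finite_measure (N j)" for j
  proof (rule finite_measureI)
    have "emeasure (N j) (space (N j)) = emeasure P (C j)"
      using N[of UNIV j] PG[OF bC] by (simp add: N_def)
    then show "emeasure (N j) (space (N j)) \<noteq> \<infinity>" using fin[OF C(1)[of j]] by simp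
  qed
  then obtain K where K: "incseq K" "\<And>n. compact (K n)" "\<And>n. K n \<subseteq> A"
    "\<And>j. emeasure (N j) (A - (\<Union>n. K n)) = 0"
    using finite_borel_inner_regular[OF lc(2), of N A] A unfolding N_def by (metis sets_distr)
  have bA: "A - (\<Union>n. K n) \<in> sets borel"
    using A K(2) by (intro sets.Diff sets.countable_UN) (auto intro: borel_closed compact_imp_closed)
  have "emeasure G (\<Union>j. C j \<times> (A - (\<Union>n. K n))) = 0"
    using N[OF bA] K(4) bC bA sG
    by (intro emeasure_UN_eq_0) (auto simp: borel_Times)
  moreover have "(\<Union>j. C j \<times> (A - (\<Union>n. K n))) = (\<Union>j. C j) \<times> (A - (\<Union>n. K n))" by auto
  ultimately have "emeasure G (UNIV \<times> (A - (\<Union>n. K n))) = 0" using C(2) by simp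
  then show ?thesis using that K(1-3) by metis
qed

end

text \<open>The kernel is zero on \<open>Z\<close> to match the convention of
  \<open>young_kernel\<close>, so that a Young function can have exactly this kernel.\<close>

theorem borel_disintegration:
  fixes G :: "('a::{second_countable_topology, t2_space} \<times> 'b::{second_countable_topology, t2_space}) measure"
    and P :: "'a measure"
  assumes lc: "locally_compact_space (euclidean :: 'a topology)"
      "locally_compact_space (euclidean :: 'b topology)"
    and sG: "sets G = sets borel" and sP: "sets P = sets borel"
    and PG: "\<And>E. E \<in> sets borel \<Longrightarrow> emeasure P E = emeasure G (E \<times> UNIV)"
    and fin: "\<And>K. compact K \<Longrightarrow> emeasure P K < \<infinity>"
  obtains \<nu> :: "'a \<Rightarrow> 'b measure" and Z where "\<nu> \<in> measurable P (subprob_algebra borel)" "Z \<in> null_sets P"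
    "\<And>x. x \<in> Z \<Longrightarrow> \<nu> x = null_measure borel" "\<And>x. x \<notin> Z \<Longrightarrow> prob_space (\<nu> x)"
    "G = graph_borel P \<nu>"
proof -
  obtain C :: "nat \<Rightarrow> 'a set" where C: "\<And>n. compact (C n)" "UNIV = (\<Union>n. C n)"
    using open_Union_compact[OF lc(1) open_UNIV] by metis
  have bC: "C n \<in> sets borel" for n using C(1) by (intro borel_closed compact_imp_closed)
  have spP: "space P = UNIV" using sets_eq_imp_space_eq[OF sP] by simp
  have finC: "emeasure P (C n) \<noteq> \<infinity>" for n using fin[OF C(1)[of n]] by simp
  have sf: "sigma_finite_measure P"
    using bC finC C(2) spP sP by (intro sigma_finite_measure.intro exI[of _ "range C"]) auto
  note ctx = sG sP PG sf
  obtain \<A>0 \<B> :: "'b set set" where A0: "countable \<A>0" "algebra UNIV \<A>0"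
    "sets borel = sigma_sets UNIV \<A>0" "countable \<B>" "topological_basis \<B>" "\<B> \<subseteq> \<A>0"
    by (rule countable_borel_algebra)
  interpret A0: algebra UNIV \<A>0 by fact
  have b0: "A \<in> sets borel" if "A \<in> \<A>0" for A using that A0(3) by auto
  have "\<forall>A\<in>\<A>0. \<exists>K :: nat \<Rightarrow> 'b set. incseq K \<and> (\<forall>n. compact (K n)) \<and> (\<forall>n. K n \<subseteq> A) \<and>
    emeasure G (UNIV \<times> (A - (\<Union>n. K n))) = 0"
    using fiber_inner_regular[OF ctx lc fin b0] by metis
  from bchoice[OF this] obtain K :: "'b set \<Rightarrow> nat \<Rightarrow> 'b set" where K: "\<And>A. A \<in> \<A>0 \<Longrightarrow> incseq (K A)"
    "\<And>A n. A \<in> \<A>0 \<Longrightarrow> compact (K A n)" "\<And>A n. A \<in> \<A>0 \<Longrightarrow> K A n \<subseteq> A"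
    "\<And>A. A \<in> \<A>0 \<Longrightarrow> emeasure G (UNIV \<times> (A - (\<Union>n. K A n))) = 0"
    by blast
  have bK: "K A n \<in> sets borel" if "A \<in> \<A>0" for A n
    using K(2)[OF that] by (intro borel_closed compact_imp_closed)
  \<comment> \<open>Regularity will be asked of the members of \<open>\<A>0\<close>, additivity of
    all of \<open>\<A>1\<close>; the sets \<open>K A n\<close> are therefore adjoined once, without
    approximating the new sets in turn.\<close>
  have "countable (\<A>0 \<union> (\<Union>A\<in>\<A>0. range (K A)))" using A0(1) by auto
  then obtain \<A>1 where A1: "countable \<A>1" "\<A>0 \<union> (\<Union>A\<in>\<A>0. range (K A)) \<subseteq> \<A>1" "algebra UNIV \<A>1"
    "\<A>1 \<subseteq> sigma_sets UNIV (\<A>0 \<union> (\<Union>A\<in>\<A>0. range (K A)))"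
    by (rule countable_generated_algebra)
  have "sigma_sets UNIV (\<A>0 \<union> (\<Union>A\<in>\<A>0. range (K A))) \<subseteq> sets (borel :: 'b measure)"
    using sets.sigma_algebra_axioms[of "borel :: 'b measure"] b0 bK
    by (intro sigma_algebra.sigma_sets_subset) auto
  with A1(4) have b1: "A \<in> sets borel" if "A \<in> \<A>1" for A using that by blast
  have "\<forall>B\<in>sets borel. \<exists>h. h \<in> borel_measurable P \<and>
    (\<forall>E\<in>sets borel. (\<integral>\<^sup>+x. h x * indicator E x \<partial>P) = emeasure G (E \<times> B))"
    using marginal_density_exists[OF ctx] by blast
  from bchoice[OF this] obtain h :: "'b set \<Rightarrow> 'a \<Rightarrow> ennreal" where
    hm: "\<And>B. B \<in> sets borel \<Longrightarrow> h B \<in> borel_measurable P" and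
    h: "\<And>B E. B \<in> sets borel \<Longrightarrow> E \<in> sets borel \<Longrightarrow> (\<integral>\<^sup>+x. h B x * indicator E x \<partial>P) = emeasure G (E \<times> B)"
    by blast
  \<comment> \<open>Countably many conditions, each valid almost everywhere; at a good point they
    make \<open>h\<close> a content on \<open>\<A>1\<close> that extends to a probability
    measure.\<close>
  define good where "good x \<longleftrightarrow> h UNIV x = 1 \<and> h {} x = 0 \<and>
    (\<forall>B\<in>\<A>1. \<forall>B'\<in>\<A>1. B \<inter> B' = {} \<longrightarrow> h (B \<union> B') x = h B x + h B' x) \<and>
    (\<forall>A\<in>\<A>0. h A x = (SUP n. h (K A n) x))" for x
  have un: "AE x in P. h (B \<union> B') x = h B x + h B' x" if "B \<in> \<A>1" "B' \<in> \<A>1" "B \<inter> B' = {}" for B B'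
    by (rule conditional_Un[OF ctx hm h b1[OF that(1)] b1[OF that(2)] that(3)])
  have "AE x in P. good x"
    unfolding good_def
  proof (intro AE_conjI)
    show "AE x in P. h UNIV x = 1" by (rule conditional_UNIV[OF ctx hm h])
    show "AE x in P. h {} x = 0" by (rule conditional_empty[OF ctx hm h])
    show "AE x in P. \<forall>B\<in>\<A>1. \<forall>B'\<in>\<A>1. B \<inter> B' = {} \<longrightarrow> h (B \<union> B') x = h B x + h B' x"
    proof (rule AE_ball_countable'[OF _ A1(1)], rule AE_ball_countable'[OF _ A1(1)])
      fix B B' assume B: "B \<in> \<A>1" "B' \<in> \<A>1"
      show "AE x in P. B \<inter> B' = {} \<longrightarrow> h (B \<union> B') x = h B x + h B' x"
      proof (cases "B \<inter> B' = {}")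
        case True
        from un[OF B this] show ?thesis by eventually_elim simp
      next
        case False
        then show ?thesis by simp
      qed
    qed
    show "AE x in P. \<forall>A\<in>\<A>0. h A x = (SUP n. h (K A n) x)"
    proof (rule AE_ball_countable'[OF _ A0(1)])
      fix A assume A: "A \<in> \<A>0"
      show "AE x in P. h A x = (SUP n. h (K A n) x)"
        by (rule conditional_SUP[OF ctx hm h K(1)[OF A] bK[OF A] K(3)[OF A] b0[OF A] K(4)[OF A]])
    qed
  qed
  then obtain Z where Z: "Z \<in> null_sets P" "\<And>x. x \<notin> Z \<Longrightarrow> good x"
    using spP by (auto elim!: AE_E simp: null_sets_def)
  have "\<forall>x\<in>-Z. \<exists>N. sets N = sigma_sets UNIV \<A>0 \<and> (\<forall>A\<in>\<A>0. emeasure N A = h A x)"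
  proof
    fix x assume "x \<in> - Z"
    then have g: "good x" using Z(2) by simp
    show "\<exists>N. sets N = sigma_sets UNIV \<A>0 \<and> (\<forall>A\<in>\<A>0. emeasure N A = h A x)"
    proof (rule compact_approximable_content_extension[of \<A>0 \<A>1 "\<lambda>A. h A x" K])
      show "algebra UNIV \<A>0" "algebra UNIV \<A>1" by fact+
      show "\<A>0 \<subseteq> \<A>1" using A1(2) by blast
      show "positive \<A>1 (\<lambda>A. h A x)" using g by (simp add: positive_def good_def)
      show "additive \<A>1 (\<lambda>A. h A x)" using g by (auto simp: additive_def good_def)
      show "h UNIV x < \<infinity>" using g by (simp add: good_def)
      show "K A n \<in> \<A>1 \<and> compact (K A n) \<and> K A n \<subseteq> A" if "A \<in> \<A>0" for A n
        using K(2,3)[OF that] A1(2) that by blast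
      show "h A x = (SUP n. h (K A n) x)" if "A \<in> \<A>0" for A
        using g that by (simp add: good_def)
    qed
  qed
  from bchoice[OF this] obtain N where N: "\<And>x. x \<notin> Z \<Longrightarrow> sets (N x) = sets borel"
    "\<And>x A. x \<notin> Z \<Longrightarrow> A \<in> \<A>0 \<Longrightarrow> emeasure (N x) A = h A x"
    using A0(3) by (metis ComplI)
  define \<nu> where "\<nu> x = (if x \<in> Z then null_measure borel else N x)" for x
  have s\<nu>: "sets (\<nu> x) = sets borel" for x using N(1) by (simp add: \<nu>_def)
  have prob: "prob_space (\<nu> x)" if "x \<notin> Z" for x
  proof (rule prob_spaceI)
    have "space (\<nu> x) = UNIV" using sets_eq_imp_space_eq[OF s\<nu>] by simp
    then show "emeasure (\<nu> x) (space (\<nu> x)) = 1"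
      using that N(2)[OF that A0.top] Z(2)[OF that] by (simp add: \<nu>_def good_def)
  qed
  have \<nu>A: "emeasure (\<nu> x) A = h A x * indicator (- Z) x" if "A \<in> \<A>0" for x A
    using N(2) that by (simp add: \<nu>_def indicator_def)
  have mZ: "- Z \<in> sets P" using Z(1) spP by (metis Compl_eq_Diff_UNIV null_setsD2 sets.compl_sets)
  have \<nu>: "\<nu> \<in> measurable P (subprob_algebra borel)"
  proof (rule measurable_subprob_algebra_generated[OF A0(3) algebra_Int_stable[OF A0(2)]])
    show "subprob_space (\<nu> x)" for x
    proof (cases "x \<in> Z")
      case True
      then show ?thesis by (auto simp: \<nu>_def intro!: subprob_spaceI)
    next
      case False
      then show ?thesis by (intro prob_space_imp_subprob_space prob)
    qed
    show "(\<lambda>x. emeasure (\<nu> x) A) \<in> borel_measurable P" if "A \<in> \<A>0" for A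
      using hm[OF b0[OF that]] mZ by (simp add: \<nu>A[OF that])
    then show "(\<lambda>x. emeasure (\<nu> x) UNIV) \<in> borel_measurable P" using A0.top by blast
  qed (auto simp: s\<nu>)
  have P': "sets borel \<subseteq> sets P" using sP by simp
  \<comment> \<open>The second factor is confined to \<open>\<A>0\<close>, where the values of
    \<open>\<nu> x\<close> are given by the densities. Products of base sets show that these
    rectangles still generate.\<close>
  let ?R = "{E \<times> A | E A. E \<in> sets (borel :: 'a measure) \<and> A \<in> \<A>0}"
  have R: "sets (borel :: ('a \<times> 'b) measure) = sigma_sets UNIV ?R"
  proof (rule antisym)
    obtain \<B>' :: "'a set set" where B': "countable \<B>'" "topological_basis \<B>'"
      using ex_countable_basis by blast
    let ?B = "(\<lambda>(a, b). a \<times> b) ` (\<B>' \<times> \<B>)"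
    have "countable ?B" using B'(1) A0(4) by auto
    then have "sets (borel :: ('a \<times> 'b) measure) = sigma_sets UNIV ?B"
      using borel_eq_countable_basis[OF _ topological_basis_prod[OF B'(2) A0(5)]] by (metis Pow_UNIV sets_measure_of subset_UNIV)
    also have "?B \<subseteq> ?R" using topological_basis_open[OF B'(2)] A0(6) by (auto intro!: exI)
    then have "sigma_sets UNIV ?B \<subseteq> sigma_sets UNIV ?R" by (rule sigma_sets_mono')
    finally show "sets (borel :: ('a \<times> 'b) measure) \<subseteq> sigma_sets UNIV ?R" .
    show "sigma_sets UNIV ?R \<subseteq> sets (borel :: ('a \<times> 'b) measure)"
      using sets.sigma_algebra_axioms[of "borel :: ('a \<times> 'b) measure"] b0
      by (intro sigma_algebra.sigma_sets_subset) (auto intro: borel_Times)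
  qed
  \<comment> \<open>\<open>G\<close> may be infinite; the cylinders \<open>C n \<times> UNIV\<close>
    supply the exhaustion by sets of finite mass.\<close>
  have "G = graph_borel P \<nu>"
  proof (rule measure_eqI_generator_eq[where E = ?R and \<Omega> = UNIV and A = "\<lambda>n. C n \<times> UNIV"])
    show "Int_stable ?R"
    proof (rule Int_stableI)
      fix X Y assume "X \<in> ?R" "Y \<in> ?R"
      then obtain E A E' A' where "X = E \<times> A" "Y = E' \<times> A'" "E \<in> sets borel" "E' \<in> sets borel"
        "A \<in> \<A>0" "A' \<in> \<A>0" by blast
      moreover from this have "X \<inter> Y = (E \<inter> E') \<times> (A \<inter> A')" by (simp add: Times_Int_Times)
      ultimately show "X \<inter> Y \<in> ?R" by blast
    qed
    show "sets G = sigma_sets UNIV ?R" using sG R by simp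
    show "sets (graph_borel P \<nu>) = sigma_sets UNIV ?R"
      using R by (simp add: sets_graph_borel[OF spP P' \<nu>])
    show "range (\<lambda>n. C n \<times> UNIV) \<subseteq> ?R" using bC A0.top by blast
    show "(\<Union>n. C n \<times> UNIV) = UNIV" using C(2) by auto
    show "emeasure G (C n \<times> UNIV) \<noteq> \<infinity>" for n using finC[of n] PG[OF bC] by simp
    fix X assume "X \<in> ?R"
    then obtain E A where X: "X = E \<times> A" "E \<in> sets borel" "A \<in> \<A>0" by blast
    have "emeasure (graph_borel P \<nu>) X = (\<integral>\<^sup>+x. emeasure (\<nu> x) A * indicator E x \<partial>P)"
      unfolding X(1) by (rule emeasure_graph_borel_Times[OF spP P' \<nu> X(2) b0[OF X(3)]])
    also have "\<dots> = (\<integral>\<^sup>+x. h A x * indicator E x \<partial>P)"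
      using AE_not_in[OF Z(1)]
      by (intro nn_integral_cong_AE) (auto simp: \<nu>A[OF X(3)])
    also have "\<dots> = emeasure G X" unfolding X(1) by (rule h[OF b0[OF X(3)] X(2)])
    finally show "emeasure G X = emeasure (graph_borel P \<nu>) X" by simp
  qed simp
  with \<nu> Z(1) prob show ?thesis by (intro that[of \<nu> Z]) (auto simp: \<nu>_def)
qed

theorem theorem3p25:
  fixes \<Gamma> :: "('a::{second_countable_topology, t2_space} \<times> 'b::{second_countable_topology, t2_space}) set
                \<Rightarrow> ennreal"
  assumes "locally_compact_space (euclidean :: 'a topology)"
    and "locally_compact_space (euclidean :: 'b topology)"
    and "radon_measure \<Gamma>"
    and "\<And>K :: 'a set. compact K \<Longrightarrow> \<Gamma> (K \<times> UNIV) < \<infinity>"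
  shows "radon_measure (push_forward fst \<Gamma>) \<and>
    (\<exists>f :: 'a \<rightharpoonup> ('b set \<Rightarrow> ennreal).
       young_function (push_forward fst \<Gamma>) f \<and> \<Gamma> = graph_measure (push_forward fst \<Gamma>) f) \<and>
    (\<forall>f g :: 'a \<rightharpoonup> ('b set \<Rightarrow> ennreal).
       young_function (push_forward fst \<Gamma>) f \<and> \<Gamma> = graph_measure (push_forward fst \<Gamma>) f \<and>
       young_function (push_forward fst \<Gamma>) g \<and> \<Gamma> = graph_measure (push_forward fst \<Gamma>) g
       \<longrightarrow> push_forward fst \<Gamma> {x. f x \<noteq> g x} = 0)"
proof -
  note lc = assms(1,2) and \<Gamma> = assms(3)
  define \<mu> where "\<mu> = push_forward fst \<Gamma>"
  have \<mu>: "radon_measure \<mu>"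
    unfolding \<mu>_def by (rule radon_measure_push_forward_fst[OF lc \<Gamma> assms(4)])
  note om = radon_outer_measure[OF \<mu>]
  let ?P = "borel_part \<mu>" and ?M = "measure_of_outer \<mu>"
  note M = space_measure_of_outer borel_part_subalgebra(1)[OF \<mu>, unfolded sets_borel_part]
  have PG: "emeasure ?P E = emeasure (borel_part \<Gamma>) (E \<times> UNIV)" if "E \<in> sets borel" for E
  proof -
    have "E \<times> (UNIV :: 'b set) \<in> sets borel" using that by (intro borel_Times) auto
    then show ?thesis
      unfolding emeasure_borel_part[OF \<mu> that] by (simp add: emeasure_borel_part[OF \<Gamma>] push_forward_fst \<mu>_def)
  qed
  obtain \<nu> Z where \<nu>: "\<nu> \<in> measurable ?P (subprob_algebra (borel :: 'b measure))" "Z \<in> null_sets ?P"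
    "\<And>x. x \<in> Z \<Longrightarrow> \<nu> x = null_measure borel" "\<And>x. x \<notin> Z \<Longrightarrow> prob_space (\<nu> x)"
    "borel_part \<Gamma> = graph_borel ?P \<nu>"
    using borel_disintegration[OF lc sets_borel_part sets_borel_part PG borel_part_finite_compact[OF \<mu>]]
    by blast
  have P': "sets borel \<subseteq> sets ?P" by simp
  note \<nu>M = graph_borel_subalgebra[OF space_borel_part sets_borel_part M borel_part_subalgebra(2)[OF \<mu>] \<nu>(1)]
  note sub = subprob_kernel[OF space_borel_part P' \<nu>(1)]
  have fin: "emeasure (\<nu> x) K < \<infinity>" for x K
    using finite_measure.emeasure_finite[OF subprob_space.axioms(1)[OF sub(1)[of x]]] by (simp add: less_top)
  \<comment> \<open>\<open>f\<close> is undefined exactly on \<open>Z\<close>, where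
    \<open>\<nu>\<close> vanishes, so its kernel equals \<open>\<nu>\<close> at every point and not
    just almost everywhere.\<close>
  define f where "f x = (if x \<in> Z then None else Some (radon_extension (\<nu> x)))" for x
  have kernel: "young_kernel f = \<nu>"
  proof
    fix x show "young_kernel f x = \<nu> x"
      using \<nu>(3)[of x] borel_part_radon_extension[OF lc(2) sub(2) fin, of x]
      by (simp add: young_kernel_def f_def)
  qed
  have f: "young_function \<mu> f"
  proof (rule young_functionI[OF om])
    have "- dom f = Z" by (auto simp: f_def dom_def)
    then show "\<mu> (- dom f) = 0"
      using \<nu>(2) emeasure_borel_part[OF \<mu>, of Z] by (auto simp: null_sets_def)
    show "ran f \<subseteq> prob_radon"
    proof
      fix \<rho> assume "\<rho> \<in> ran f"
      then obtain x where x: "x \<notin> Z" "\<rho> = radon_extension (\<nu> x)"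
        by (auto simp: ran_def f_def split: if_splits)
      have "radon_extension (\<nu> x) UNIV = emeasure (\<nu> x) UNIV"
        by (rule radon_extension_open[OF sub(2) open_UNIV])
      also have "\<dots> = 1" using prob_space.emeasure_space_1[OF \<nu>(4)[OF x(1)]] by (simp add: sub(3))
      finally show "\<rho> \<in> prob_radon"
        using radon_measure_radon_extension[OF lc(2) sub(2) fin, of x] x(2) by (simp add: prob_radon_def)
    qed
    show "(\<lambda>x. measure (young_kernel f x) V) \<in> borel_measurable ?M" if "open V" for V
      unfolding kernel using that
      by (intro measurable_compose[OF \<nu>M(1) measurable_measure_subprob_algebra] borel_open)
  qed
  \<comment> \<open>The Borel part of the graph measure is the mixture over \<open>?M\<close>, which
    equals the one over \<open>?P\<close>. Radon measures with the same Borel part coincide.\<close>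
  have "borel_part (graph_measure \<mu> f) = borel_part \<Gamma>"
    by (simp only: borel_part_graph_measure(2)[OF lc \<mu> f] kernel \<nu>M(2) \<nu>(5))
  then have "\<Gamma> = graph_measure \<mu> f"
    using radon_extension_borel_part[OF \<Gamma>]
      radon_extension_borel_part[OF borel_part_graph_measure(1)[OF lc \<mu> f]] by simp
  moreover have "\<mu> {x. g x \<noteq> g' x} = 0"
    if "young_function \<mu> g" "\<Gamma> = graph_measure \<mu> g" "young_function \<mu> g'" "\<Gamma> = graph_measure \<mu> g'"
    for g g' :: "'a \<rightharpoonup> ('b set \<Rightarrow> ennreal)"
    using that by (intro young_function_AE_unique[OF lc \<mu>]) simp_all
  ultimately show ?thesis
    using \<mu> f unfolding \<mu>_def by blast
qed

end
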